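(* Let $\mathbb F$ be a field and, for a (nonempty) finite digraph $\Gamma$, let $L(\Gamma)$ be its Leavitt path algebra over $\mathbb F$. If $L(\Gamma)$ has finite Gelfand-Kirillov dimension then $L(\Gamma)$ has a nonzero finite dimensional quotient; and if $L(\Gamma)$ has a nonzero finite dimensional quotient then $L(\Gamma)$ has IBN. Neither of these implications is reversible: there is a finite digraph $\Gamma_1$ such that $L(\Gamma_1)$ has a nonzero finite dimensional quotient but infinite Gelfand-Kirillov dimension, and there is a finite digraph $\Gamma_2$ such that $L(\Gamma_2)$ has IBN but no nonzero finite dimensional quotient.
   Context: A digraph $\Gamma=(V,E,s,t)$ is finite if its vertex set $V$ and arrow set $E$ are finite; $s,t:E\to V$ are the source and target maps. $L(\Gamma)$ is the $\mathbb F$-algebra generated by $V\sqcup E\sqcup E^*$, where $E^*=\{e^*: e\in E\}$, $s(e^* )=t(e)$, $t(e^* )=s(e)$, subject to: (V) $vw=\delta_{v,w}v$ for $v,w\in V$; (E) $s(e)e=e=e\,t(e)$ for $e\in E\sqcup E^*$; (CK1) $e^*f=\delta_{e,f}\,t(e)$ for $e,f\in E$; (CK2) $v=\sum_{s(e)=v}ee^*$ for every $v\in V$ with $s^{-1}(v)\neq\emptyset$. Its unit is $\sum_{v\in V}v$. A ring $R$ with $1$ has IBN (Invariant Basis Number) if $R^m\cong R^n$ as $R$-modules implies $m=n$. *)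

theory Defs
  imports
    "HOL-Algebra.QuotRing"
    "HOL-Algebra.Embedded_Algebras"
    "HOL-Algebra.Module"
    "HOL-Library.Poly_Mapping"
    "HOL-Library.FuncSet"
    "HOL-Library.Extended_Real"
    "HOL-Library.Liminf_Limsup"
    "Graph_Theory.Digraph"
    Complex_Main
begin

section \<open>Free algebras\<close>

text \<open>Words under concatenation form the free monoid; the finitely supported functions from words
  to coefficients, with the convolution product of \<^theory>\<open>HOL-Library.Poly_Mapping\<close>, form the free
  unital associative algebra. The coefficient field is the type \<open>'k\<close>.\<close>

datatype 'x word = Word (letters: "'x list")

instantiation word :: (type) monoid_add
begin

definition zero_word :: "'x word" where
  "zero_word = Word []"

definition plus_word :: "'x word \<Rightarrow> 'x word \<Rightarrow> 'x word" where
  "plus_word u w = Word (letters u @ letters w)"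

instance
  by standard (simp_all add: zero_word_def plus_word_def)

end

type_synonym ('x, 'k) ncpoly = "'x word \<Rightarrow>\<^sub>0 'k"

definition ncvar :: "'x \<Rightarrow> ('x, 'k::field) ncpoly" where
  "ncvar x = Poly_Mapping.single (Word [x]) 1"

definition ncconst :: "'k \<Rightarrow> ('x, 'k::field) ncpoly" where
  "ncconst c = Poly_Mapping.single 0 c"

definition free_algebra :: "'k itself \<Rightarrow> 'x set \<Rightarrow> ('x, 'k::field) ncpoly ring" where
  "free_algebra _ X =
     \<lparr>carrier = {p. \<forall>w \<in> Poly_Mapping.keys p. set (letters w) \<subseteq> X},
      mult = (*), one = 1, zero = 0, add = (+)\<rparr>"

lemma letters_zero [simp]: "letters 0 = []"
  by (simp add: zero_word_def)

lemma letters_plus [simp]: "letters (u + w) = letters u @ letters w"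
  by (simp add: plus_word_def)

lemma free_algebra_ring: "ring (free_algebra TYPE('k::field) X)"
proof (rule ringI)
  show "abelian_group (free_algebra TYPE('k) X)"
  proof (rule abelian_groupI)
    fix x assume "x \<in> carrier (free_algebra TYPE('k) X)"
    then have "- x \<in> carrier (free_algebra TYPE('k) X)"
      by (auto simp: free_algebra_def)
    then show "\<exists>y \<in> carrier (free_algebra TYPE('k) X).
        y \<oplus>\<^bsub>free_algebra TYPE('k) X\<^esub> x = \<zero>\<^bsub>free_algebra TYPE('k) X\<^esub>"
      by (intro bexI[of _ "- x"]) (simp_all add: free_algebra_def)
  qed (use keys_add in \<open>fastforce simp: free_algebra_def algebra_simps\<close>)+
  show "Group.monoid (free_algebra TYPE('k) X)"
  proof (rule monoidI)
    fix x y :: "('a, 'k) ncpoly"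
    assume "x \<in> carrier (free_algebra TYPE('k) X)" "y \<in> carrier (free_algebra TYPE('k) X)"
    then show "x \<otimes>\<^bsub>free_algebra TYPE('k) X\<^esub> y \<in> carrier (free_algebra TYPE('k) X)"
      using keys_mult[of x y] by (fastforce simp: free_algebra_def)
  qed (simp_all add: free_algebra_def mult.assoc)
qed (simp_all add: free_algebra_def algebra_simps)


section \<open>Leavitt path algebras\<close>

text \<open>\<open>Ghost e\<close> is the generator \<open>e\<^sup>*\<close>.\<close>

datatype ('v, 'e) leavitt_gen = Vert 'v | Arc 'e | Ghost 'e

fun gen_src :: "('v, 'e) pre_digraph \<Rightarrow> ('v, 'e) leavitt_gen \<Rightarrow> 'v" where
  "gen_src G (Vert v) = v"
| "gen_src G (Arc e) = tail G e"
| "gen_src G (Ghost e) = head G e"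

fun gen_tgt :: "('v, 'e) pre_digraph \<Rightarrow> ('v, 'e) leavitt_gen \<Rightarrow> 'v" where
  "gen_tgt G (Vert v) = v"
| "gen_tgt G (Arc e) = head G e"
| "gen_tgt G (Ghost e) = tail G e"

definition leavitt_gens :: "('v, 'e) pre_digraph \<Rightarrow> ('v, 'e) leavitt_gen set" where
  "leavitt_gens G = Vert ` verts G \<union> Arc ` arcs G \<union> Ghost ` arcs G"

text \<open>Every relation is written as an element that becomes zero. The last family is needed because
  \<^const>\<open>free_algebra\<close> is unital: it makes \<open>1\<close> the sum of the vertices, so that the quotient is the
  algebra presented (as a not necessarily unital algebra) by the other relations, with its unit.\<close>

definition leavitt_rels ::
    "'k itself \<Rightarrow> ('v, 'e) pre_digraph \<Rightarrow> (('v, 'e) leavitt_gen, 'k::field) ncpoly set" where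
  "leavitt_rels _ G =
     {ncvar (Vert v) * ncvar (Vert w) - (if v = w then ncvar (Vert v) else 0) | v w.
        v \<in> verts G \<and> w \<in> verts G}
   \<union> {ncvar (Vert (gen_src G x)) * ncvar x - ncvar x | x. x \<in> Arc ` arcs G \<union> Ghost ` arcs G}
   \<union> {ncvar x * ncvar (Vert (gen_tgt G x)) - ncvar x | x. x \<in> Arc ` arcs G \<union> Ghost ` arcs G}
   \<union> {ncvar (Ghost e) * ncvar (Arc f) - (if e = f then ncvar (Vert (head G e)) else 0) | e f.
        e \<in> arcs G \<and> f \<in> arcs G}
   \<union> {ncvar (Vert v) - (\<Sum>e \<in> out_arcs G v. ncvar (Arc e) * ncvar (Ghost e)) | v.
        v \<in> verts G \<and> out_arcs G v \<noteq> {}}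
   \<union> {1 - (\<Sum>v \<in> verts G. ncvar (Vert v))}"

definition leavitt_ideal ::
    "'k itself \<Rightarrow> ('v, 'e) pre_digraph \<Rightarrow> (('v, 'e) leavitt_gen, 'k::field) ncpoly set" where
  "leavitt_ideal K G = Idl\<^bsub>free_algebra K (leavitt_gens G)\<^esub> (leavitt_rels K G)"

definition leavitt_path_algebra ::
    "'k itself \<Rightarrow> ('v, 'e) pre_digraph \<Rightarrow> (('v, 'e) leavitt_gen, 'k::field) ncpoly set ring" where
  "leavitt_path_algebra K G = free_algebra K (leavitt_gens G) Quot leavitt_ideal K G"

text \<open>The copy of the ground field inside the algebra, through which the library's notions of
  dimension over a subfield apply.\<close>

definition leavitt_scalars ::
    "'k itself \<Rightarrow> ('v, 'e) pre_digraph \<Rightarrow> (('v, 'e) leavitt_gen, 'k::field) ncpoly set set" where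
  "leavitt_scalars K G =
     range (\<lambda>c. leavitt_ideal K G +>\<^bsub>free_algebra K (leavitt_gens G)\<^esub> ncconst c)"

lemma free_algebra_closed:
  fixes X :: "'x set"
  defines "C \<equiv> carrier (free_algebra TYPE('k::field) X)"
  shows "0 \<in> C" "1 \<in> C" "p \<in> C \<Longrightarrow> q \<in> C \<Longrightarrow> p + q \<in> C" "p \<in> C \<Longrightarrow> q \<in> C \<Longrightarrow> p - q \<in> C"
    "p \<in> C \<Longrightarrow> q \<in> C \<Longrightarrow> p * q \<in> C" "x \<in> X \<Longrightarrow> ncvar x \<in> C" "ncconst c \<in> C"
    "(\<And>i. i \<in> J \<Longrightarrow> h i \<in> C) \<Longrightarrow> sum h J \<in> C"
proof -
  show *: "0 \<in> C" "1 \<in> C" "x \<in> X \<Longrightarrow> ncvar x \<in> C" "ncconst c \<in> C"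
    by (auto simp: C_def free_algebra_def ncvar_def ncconst_def split: if_splits)
  show add: "p \<in> C \<Longrightarrow> q \<in> C \<Longrightarrow> p + q \<in> C" for p q
    using keys_add[of p q] by (fastforce simp: C_def free_algebra_def)
  show "p \<in> C \<Longrightarrow> q \<in> C \<Longrightarrow> p - q \<in> C"
    using keys_diff[of p q] by (fastforce simp: C_def free_algebra_def)
  show "p \<in> C \<Longrightarrow> q \<in> C \<Longrightarrow> p * q \<in> C"
    using keys_mult[of p q] by (fastforce simp: C_def free_algebra_def)
  show "(\<And>i. i \<in> J \<Longrightarrow> h i \<in> C) \<Longrightarrow> sum h J \<in> C"
    by (induction J rule: infinite_finite_induct) (auto intro: add *)
qed

lemma leavitt_rels_carrier:
  assumes "fin_digraph G"
  shows "leavitt_rels TYPE('k::field) G \<subseteq> carrier (free_algebra TYPE('k) (leavitt_gens G))"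
proof -
  interpret fin_digraph G by fact
  show ?thesis
    unfolding leavitt_rels_def
    by (auto intro!: free_algebra_closed simp: leavitt_gens_def)
qed

lemma leavitt_ideal_ideal:
  assumes "fin_digraph G"
  shows "ideal (leavitt_ideal TYPE('k::field) G) (free_algebra TYPE('k) (leavitt_gens G))"
  unfolding leavitt_ideal_def
  by (intro ring.genideal_ideal free_algebra_ring leavitt_rels_carrier assms)

lemma leavitt_path_algebra_ring:
  assumes "fin_digraph G"
  shows "ring (leavitt_path_algebra TYPE('k::field) G)"
  unfolding leavitt_path_algebra_def
  by (intro ideal.quotient_is_ring leavitt_ideal_ideal assms)


section \<open>Gelfand-Kirillov dimension, finite-dimensional quotients, invariant basis number\<close>

text \<open>Below, an algebra over a field is a ring \<open>A\<close> together with a central subfield \<open>K\<close>.\<close>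

text \<open>If \<open>V\<close> is the \<open>K\<close>-span of \<open>Us\<close>, then \<open>growth K A Us n\<close> is the dimension over \<open>K\<close> of
  \<open>V\<^sup>0 + V\<^sup>1 + \<dots> + V\<^sup>n\<close>, which is spanned by the products of at most \<open>n\<close> entries of \<open>Us\<close>.\<close>

definition growth :: "'a set \<Rightarrow> ('a, 'b) ring_scheme \<Rightarrow> 'a list \<Rightarrow> nat \<Rightarrow> nat" where
  "growth K A Us n =
     ring.dim A K
       (ring.Span A K
         (map (\<lambda>xs. foldr (\<otimes>\<^bsub>A\<^esub>) xs \<one>\<^bsub>A\<^esub>) (concat (map (\<lambda>i. List.n_lists i Us) [0..<Suc n]))))"

definition GK_dim :: "'a set \<Rightarrow> ('a, 'b) ring_scheme \<Rightarrow> ereal" where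
  "GK_dim K A =
     (SUP Us \<in> {Us. set Us \<subseteq> carrier A}.
        limsup (\<lambda>n. ereal (log (real n) (real (growth K A Us n)))))"

text \<open>An algebra quotient is a quotient by a two-sided ideal \<open>I\<close> of the ring \<open>A\<close>, since such an
  ideal is automatically a \<open>K\<close>-subspace; \<open>K\<close> acts on it through its image.\<close>

definition has_nonzero_fd_quotient :: "'a set \<Rightarrow> ('a, 'b) ring_scheme \<Rightarrow> bool" where
  "has_nonzero_fd_quotient K A \<longleftrightarrow>
     (\<exists>I. ideal I A \<and> carrier (A Quot I) \<noteq> {\<zero>\<^bsub>A Quot I\<^esub>} \<and>
          ring.finite_dimension (A Quot I) ((\<lambda>c. I +>\<^bsub>A\<^esub> c) ` K) (carrier (A Quot I)))"

text \<open>The library locale for modules assumes a commutative base ring, so only its record type is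
  used here; the multiplicative fields of that record play no role in a module.\<close>

definition free_module :: "('a, 'b) ring_scheme \<Rightarrow> nat \<Rightarrow> ('a, nat \<Rightarrow> 'a) module" where
  "free_module R n =
     \<lparr>carrier = {..<n} \<rightarrow>\<^sub>E carrier R, mult = undefined, one = undefined,
      zero = (\<lambda>i \<in> {..<n}. \<zero>\<^bsub>R\<^esub>), add = (\<lambda>x y. \<lambda>i \<in> {..<n}. x i \<oplus>\<^bsub>R\<^esub> y i),
      smult = (\<lambda>r x. \<lambda>i \<in> {..<n}. r \<otimes>\<^bsub>R\<^esub> x i)\<rparr>"

definition module_isos ::
    "('a, 'r) ring_scheme \<Rightarrow> ('a, 'b, 'm) module_scheme \<Rightarrow> ('a, 'c, 'n) module_scheme \<Rightarrow> ('b \<Rightarrow> 'c) set"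
  where
  "module_isos R M N =
     {h. bij_betw h (carrier M) (carrier N) \<and>
         (\<forall>x \<in> carrier M. \<forall>y \<in> carrier M. h (x \<oplus>\<^bsub>M\<^esub> y) = h x \<oplus>\<^bsub>N\<^esub> h y) \<and>
         (\<forall>r \<in> carrier R. \<forall>x \<in> carrier M. h (r \<odot>\<^bsub>M\<^esub> x) = r \<odot>\<^bsub>N\<^esub> h x)}"

definition IBN :: "('a, 'b) ring_scheme \<Rightarrow> bool" where
  "IBN R \<longleftrightarrow> (\<forall>m n. module_isos R (free_module R m) (free_module R n) \<noteq> {} \<longrightarrow> m = n)"

end

(*
A branching system assigns pairwise disjoint sets X(v) to the vertices and identifies X(v), for v
not a sink, with the disjoint union of the sets X(t(e)) over the arcs e leaving v. The Leavitt path
algebra then acts on the functions on the union of the X(v). With infinite sets this shows that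
every vertex is nonzero. With finite sets, that is, for a nonzero solution d in the natural numbers
of d(v) = sum of the d(t(e)), it gives a finite-dimensional quotient.

If two distinct arcs leave v and both heads lead back to v, the resulting two closed paths p, q
satisfy p* p = q* q = v and p* q = 0, so that the 2^n words of length n in p*, q* are independent
and the growth is exponential. If this never happens, choose a sink or closed path that no other
closed path leads to; counting the paths that end there is a solution d.

For IBN let an invertible matrix over the algebra act on two representations that coincide on all
but finitely many basis vectors. Comparing the codimensions of the image of the common part gives
m s = n s, where s is the difference of the numbers of basis vectors. A finite-dimensional quotient
is compared with the zero representation. For two loops at u and two arcs from u to a sink w, a
harmonic function is a multiple of (d(u), d(w)) = (-2, 1), so there is no finite-dimensional
quotient, while two infinite branching systems that differ by these numbers of points give IBN.
*)

theory Submission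
  imports
    Defs
    "HOL-Library.Function_Algebras"
    "HOL-Library.Countable_Set"
    "HOL-Real_Asymp.Real_Asymp"
begin

text \<open>Why the numbers d occur: in a finite-dimensional representation V, (CK1) and (CK2) say
  that the arcs leaving v identify vV with the direct sum of the spaces t(e)V, so d(v) = dim vV is
  such a solution. More generally, an additive integer-valued invariant of finitely generated
  projective modules gives an integer solution d, possibly with negative entries, and takes the
  value n s on the free module of rank n, where s is the sum of all d(v). Hence IBN already follows
  from s \<noteq> 0, while a nonzero finite-dimensional quotient requires d \<ge> 0 as well; the
  second example lives in this gap. A negative entry is not a dimension. It has to be realised as an
  index, the difference of two infinite-dimensional representations, which is why dimension is
  replaced by relative codimension. The other obstacle is that a presentation by generators and
  relations never shows an element to be nonzero. Every statement of that kind is therefore read off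
  from a representation.\<close>

section \<open>Index of maps that agree up to finitely many basis vectors\<close>

text \<open>\<open>B\<close> may be infinite, so whole bases cannot be counted. But the finitely
  many vectors of \<open>C\<close> involve only a finite \<open>T \<subseteq> B\<close>, and the
  exchange bound for \<open>T \<union> C\<close> inside the span of \<open>T \<union> D\<close>
  leaves the claim once \<open>card T\<close> is cancelled.\<close>

lemma (in vector_space) card_le_of_common_part:
  assumes C: "independent (B \<union> C)" "B \<inter> C = {}" "finite C" and D: "finite D"
    and sub: "C \<subseteq> span (B \<union> D)"
  shows "card C \<le> card D"
proof -
  have "\<exists>T. finite T \<and> T \<subseteq> B \<and> C' \<subseteq> span (T \<union> D)" if "finite C'" "C' \<subseteq> span (B \<union> D)" for C'
    using that
  proof (induction C')
    case empty
    then show ?case by auto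
  next
    case (insert c C')
    then obtain T where T: "finite T" "T \<subseteq> B" "C' \<subseteq> span (T \<union> D)"
      by auto
    from insert.prems have "c \<in> span (B \<union> D)" by simp
    then obtain U r where U: "finite U" "U \<subseteq> B \<union> D" "c = (\<Sum>a\<in>U. r a *s a)"
      unfolding span_explicit by auto
    have "c \<in> span U"
      unfolding U(3) by (intro span_sum span_scale span_base)
    moreover have "span U \<subseteq> span (T \<union> (U \<inter> B) \<union> D)" "span (T \<union> D) \<subseteq> span (T \<union> (U \<inter> B) \<union> D)"
      using U(2) by (auto intro!: span_mono)
    ultimately show ?case
      using T U(1) by (intro exI[of _ "T \<union> (U \<inter> B)"]) auto
  qed
  from this[OF C(3) sub] obtain T where T: "finite T" "T \<subseteq> B" "C \<subseteq> span (T \<union> D)"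
    by auto
  have ind: "independent (T \<union> C)"
    using C(1) by (rule independent_mono) (use T(2) in auto)
  have "T \<union> C \<subseteq> span (T \<union> D)"
    using T(3) span_superset[of "T \<union> D"] by auto
  from independent_span_bound[OF _ ind this] T(1) D
  have "card (T \<union> C) \<le> card (T \<union> D)" by auto
  moreover have "card (T \<union> C) = card T + card C"
    using T C by (intro card_Un_disjoint) auto
  ultimately show ?thesis
    using card_Un_le[of T D] by linarith
qed

text \<open>Both numbers are the codimension of \<open>span B\<close> in the common span, finite
  even when \<open>B\<close> is infinite.\<close>

lemma (in vector_space) card_complement_unique:
  assumes "independent (B \<union> C)" "B \<inter> C = {}" "finite C"
    and "independent (B \<union> D)" "B \<inter> D = {}" "finite D"
    and "span (B \<union> C) = span (B \<union> D)"
  shows "card C = card D"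
  using card_le_of_common_part[of B C D] card_le_of_common_part[of B D C] assms
    span_superset[of "B \<union> C"] span_superset[of "B \<union> D"]
  by (metis Un_subset_iff antisym)

section \<open>Finitely supported functions and their standard basis\<close>

definition fscale :: "'k::field \<Rightarrow> ('x \<Rightarrow> 'k) \<Rightarrow> 'x \<Rightarrow> 'k" where
  "fscale c f = (\<lambda>x. c * f x)"

lemma fscale_apply: "fscale c f x = c * f x"
  by (simp add: fscale_def)

interpretation fv: vector_space fscale
  by standard (auto simp: fun_eq_iff fscale_apply algebra_simps)

text \<open>A subset of the type of all functions, so that spaces over different index sets lie in
  one vector space and maps on them can be compared on common basis vectors.\<close>

definition Fin :: "'x set \<Rightarrow> ('x \<Rightarrow> 'k::field) set" where
  "Fin X = {f. finite {x. f x \<noteq> 0} \<and> {x. f x \<noteq> 0} \<subseteq> X}"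

definition delta :: "'x \<Rightarrow> 'x \<Rightarrow> 'k::field" where
  "delta x = (\<lambda>y. if y = x then 1 else 0)"

lemma delta_simps [simp]: "delta x x = 1" "y \<noteq> x \<Longrightarrow> delta x y = 0"
  by (auto simp: delta_def)

lemma inj_delta: "inj_on (delta :: 'x \<Rightarrow> 'x \<Rightarrow> 'k::field) S"
  by (rule inj_onI) (metis delta_simps one_neq_zero)

lemma delta_in_Fin [simp]: "delta x \<in> Fin X \<longleftrightarrow> x \<in> X"
  by (auto simp: Fin_def delta_def)

lemma Fin_subspace: "fv.subspace (Fin X :: ('x \<Rightarrow> 'k::field) set)"
proof (rule fv.subspaceI)
  fix f g :: "'x \<Rightarrow> 'k" assume "f \<in> Fin X" "g \<in> Fin X"
  moreover have "{x. (f + g) x \<noteq> 0} \<subseteq> {x. f x \<noteq> 0} \<union> {x. g x \<noteq> 0}" by auto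
  ultimately show "f + g \<in> Fin X"
    unfolding Fin_def by (auto intro: finite_subset)
next
  fix f :: "'x \<Rightarrow> 'k" and c assume "f \<in> Fin X"
  moreover have "{x. fscale c f x \<noteq> 0} \<subseteq> {x. f x \<noteq> 0}" by (auto simp: fscale_apply)
  ultimately show "fscale c f \<in> Fin X"
    unfolding Fin_def by (auto intro: finite_subset)
qed (simp add: Fin_def)

lemma sum_fun_apply: "(\<Sum>i\<in>I. f i) x = (\<Sum>i\<in>I. f i x)"
  for f :: "'i \<Rightarrow> 'x \<Rightarrow> 'k::comm_monoid_add"
  by (induction I rule: infinite_finite_induct) auto

lemma Fin_expand:
  assumes "f \<in> Fin X"
  shows "f = (\<Sum>x | f x \<noteq> 0. fscale (f x) (delta x))"
proof
  fix y
  have fin: "finite {x. f x \<noteq> 0}" using assms by (simp add: Fin_def)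
  have "(\<Sum>x | f x \<noteq> 0. fscale (f x) (delta x)) y = (\<Sum>x | f x \<noteq> 0. f x * delta x y)"
    by (simp add: sum_fun_apply fscale_apply)
  also have "\<dots> = (\<Sum>x | f x \<noteq> 0. if y = x then f x else 0)"
    by (intro sum.cong) (auto simp: delta_def)
  also have "\<dots> = f y"
    using fin by (simp add: sum.delta')
  finally show "f y = (\<Sum>x | f x \<noteq> 0. fscale (f x) (delta x)) y" ..
qed

lemma span_delta: "fv.span (delta ` X) = (Fin X :: ('x \<Rightarrow> 'k::field) set)"
proof
  show "fv.span (delta ` X) \<subseteq> (Fin X :: ('x \<Rightarrow> 'k) set)"
    by (rule fv.span_minimal) (auto simp: Fin_subspace)
  show "Fin X \<subseteq> fv.span (delta ` X :: ('x \<Rightarrow> 'k) set)"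
  proof
    fix f :: "'x \<Rightarrow> 'k" assume f: "f \<in> Fin X"
    then have "delta x \<in> (delta ` X :: ('x \<Rightarrow> 'k) set)" if "f x \<noteq> 0" for x
      using that by (auto simp: Fin_def)
    then have "(\<Sum>x | f x \<noteq> 0. fscale (f x) (delta x)) \<in> fv.span (delta ` X)"
      by (intro fv.span_sum fv.span_scale fv.span_base) auto
    then show "f \<in> fv.span (delta ` X)"
      using Fin_expand[OF f] by simp
  qed
qed

lemma independent_delta: "fv.independent (delta ` X :: ('x \<Rightarrow> 'k::field) set)"
proof
  assume "fv.dependent (delta ` X :: ('x \<Rightarrow> 'k) set)"
  then obtain x where x: "x \<in> X" "(delta x :: 'x \<Rightarrow> 'k) \<in> fv.span (delta ` X - {delta x})"
    unfolding fv.dependent_def by auto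
  have "delta ` X - {delta x} = (delta ` (X - {x}) :: ('x \<Rightarrow> 'k) set)"
    using inj_delta[of UNIV] by (auto simp: inj_on_def)
  with x show False
    by (simp add: span_delta)
qed

text \<open>If \<open>M\<close> and \<open>M'\<close> agree on \<open>delta ` Y\<close>, the image of \<open>Fin Y\<close> has finite codimension in
  \<open>Fin T'\<close>, and this codimension can be read off from either map.\<close>

lemma index_formula:
  fixes M M' :: "('s \<Rightarrow> 'k::field) \<Rightarrow> 't \<Rightarrow> 'k"
  assumes lin: "Vector_Spaces.linear fscale fscale M" "Vector_Spaces.linear fscale fscale M'"
    and bij: "bij_betw M (Fin S) (Fin T)" "bij_betw M' (Fin S') (Fin T')"
    and T: "T \<subseteq> T'" "finite (T' - T)"
    and Y: "Y \<subseteq> S" "Y \<subseteq> S'" "finite (S - Y)" "finite (S' - Y)"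
    and agree: "\<And>y. y \<in> Y \<Longrightarrow> M (delta y) = M' (delta y)"
  shows "card (S - Y) + card (T' - T) = card (S' - Y)"
proof -
  interpret vp: vector_space_pair "fscale :: 'k \<Rightarrow> ('s \<Rightarrow> 'k) \<Rightarrow> _" "fscale :: 'k \<Rightarrow> ('t \<Rightarrow> 'k) \<Rightarrow> _"
    by unfold_locales
  have ind: "fv.independent (N ` delta ` Z)" and span: "fv.span (N ` delta ` Z) = Fin W"
    and inj: "inj_on (\<lambda>z. N (delta z)) Z"
    if N: "Vector_Spaces.linear fscale fscale N" "bij_betw N (Fin Z) (Fin W)"
    for N :: "('s \<Rightarrow> 'k) \<Rightarrow> 't \<Rightarrow> 'k" and Z W
  proof -
    have "inj_on N (Fin Z)" using N(2) by (simp add: bij_betw_def)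
    then show "fv.independent (N ` delta ` Z)"
      by (intro vp.linear_independent_injective_image N independent_delta) (simp add: span_delta)
    show "fv.span (N ` delta ` Z) = Fin W"
      using N by (simp add: vp.linear_span_image span_delta bij_betw_def)
    have "inj_on N (delta ` Z)"
      using \<open>inj_on N (Fin Z)\<close> by (rule inj_on_subset) auto
    then show "inj_on (\<lambda>z. N (delta z)) Z"
      using inj_delta[of Z] by (metis (no_types, lifting) comp_inj_on comp_def inj_on_cong)
  qed
  define B where "B = M ` delta ` Y"
  define A where "A = M ` delta ` (S - Y)"
  define C where "C = M' ` delta ` (S' - Y)"
  have B': "B = M' ` delta ` Y"
    using agree by (auto simp: B_def image_iff)
  have SA: "M ` delta ` S = B \<union> A"
    unfolding A_def B_def using Y(1) by (simp add: Un_absorb1 flip: image_Un)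
  have SC: "M' ` delta ` S' = B \<union> C"
    unfolding C_def B' using Y(2) by (simp add: Un_absorb1 flip: image_Un)
  have span_ext: "fv.span (B \<union> A \<union> delta ` E) = Fin (T \<union> E)" for E
  proof -
    have "fv.span (B \<union> A \<union> delta ` E) = fv.span (delta ` T \<union> delta ` E)"
      using span[OF lin(1) bij(1)] by (simp add: fv.span_Un SA span_delta)
    then show ?thesis
      by (simp flip: image_Un add: span_delta)
  qed
  have ind_ext: "fv.independent (B \<union> A \<union> delta ` E)" if "finite E" "E \<inter> T = {}" for E
    using that
  proof (induction E)
    case empty
    then show ?case using ind[OF lin(1) bij(1)] by (simp add: SA)
  next
    case (insert x E)
    then have "delta x \<notin> fv.span (B \<union> A \<union> delta ` E)"
      by (simp add: span_ext)
    with insert show ?case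
      by (simp add: fv.independent_insertI)
  qed
  have disj: "(B \<union> A) \<inter> delta ` (T' - T) = {}"
  proof -
    have "B \<union> A \<subseteq> Fin T"
      using span[OF lin(1) bij(1)] fv.span_superset[of "B \<union> A"] by (simp add: SA)
    then show ?thesis by auto
  qed
  have inj1: "inj_on (\<lambda>z. M (delta z)) S" and inj2: "inj_on (\<lambda>z. M' (delta z)) S'"
    using inj lin bij by blast+
  have BA: "B \<inter> A = {}"
    using inj1 Y by (auto simp: B_def A_def inj_on_def)
  have BC: "B \<inter> C = {}"
    using inj2 Y by (auto simp: B' C_def inj_on_def)
  \<comment> \<open>Both sets complete \<open>B\<close> to a basis of \<open>Fin T'\<close>: on the
    left the other images under \<open>M\<close> complete it to a basis of \<open>Fin T\<close> and
    the points of \<open>T' - T\<close> are added, on the right the other images under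
    \<open>M'\<close> suffice.\<close>
  have "card (A \<union> delta ` (T' - T)) = card C"
  proof (rule fv.card_complement_unique)
    show "fv.independent (B \<union> (A \<union> delta ` (T' - T)))"
      using ind_ext[of "T' - T"] T by (auto simp: Un_assoc)
    show "fv.independent (B \<union> C)"
      using ind[OF lin(2) bij(2)] by (simp add: SC)
    show "fv.span (B \<union> (A \<union> delta ` (T' - T))) = fv.span (B \<union> C)"
      using span_ext[of "T' - T"] span[OF lin(2) bij(2)] T by (simp add: SC Un_assoc Un_absorb1)
  qed (use disj BA BC T Y in \<open>auto simp: A_def C_def\<close>)
  moreover have "card (A \<union> delta ` (T' - T)) = card A + card (delta ` (T' - T) :: ('t \<Rightarrow> 'k) set)"
    using disj T Y by (intro card_Un_disjoint) (auto simp: A_def)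
  moreover have "card A = card (S - Y)"
    unfolding A_def image_image by (rule card_image, rule inj_on_subset[OF inj1]) auto
  moreover have "card C = card (S' - Y)"
    unfolding C_def image_image by (rule card_image, rule inj_on_subset[OF inj2]) auto
  moreover have "card (delta ` (T' - T) :: ('t \<Rightarrow> 'k) set) = card (T' - T)"
    by (rule card_image inj_delta)+
  ultimately show ?thesis by simp
qed

section \<open>An invariant basis number criterion\<close>

lemma free_module_simps:
  "carrier (free_module R n) = {..<n} \<rightarrow>\<^sub>E carrier R"
  "\<zero>\<^bsub>free_module R n\<^esub> = (\<lambda>i \<in> {..<n}. \<zero>\<^bsub>R\<^esub>)"
  "x \<oplus>\<^bsub>free_module R n\<^esub> y = (\<lambda>i \<in> {..<n}. x i \<oplus>\<^bsub>R\<^esub> y i)"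
  "r \<odot>\<^bsub>free_module R n\<^esub> x = (\<lambda>i \<in> {..<n}. r \<otimes>\<^bsub>R\<^esub> x i)"
  by (simp_all add: free_module_def)

definition unit_vec :: "('a, 'b) ring_scheme \<Rightarrow> nat \<Rightarrow> nat \<Rightarrow> nat \<Rightarrow> 'a" where
  "unit_vec R n k = (\<lambda>i \<in> {..<n}. if i = k then \<one>\<^bsub>R\<^esub> else \<zero>\<^bsub>R\<^esub>)"

text \<open>The conditions of \<open>module_isos\<close> with bijectivity weakened to
  well-definedness, so that an isomorphism and its inverse share one matrix computation.\<close>

definition free_module_hom ::
    "('a, 'b) ring_scheme \<Rightarrow> nat \<Rightarrow> nat \<Rightarrow> ((nat \<Rightarrow> 'a) \<Rightarrow> nat \<Rightarrow> 'a) \<Rightarrow> bool" where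
  "free_module_hom R m n h \<longleftrightarrow>
     h \<in> carrier (free_module R m) \<rightarrow> carrier (free_module R n) \<and>
     (\<forall>x \<in> carrier (free_module R m). \<forall>y \<in> carrier (free_module R m).
        h (x \<oplus>\<^bsub>free_module R m\<^esub> y) = h x \<oplus>\<^bsub>free_module R n\<^esub> h y) \<and>
     (\<forall>r \<in> carrier R. \<forall>x \<in> carrier (free_module R m).
        h (r \<odot>\<^bsub>free_module R m\<^esub> x) = r \<odot>\<^bsub>free_module R n\<^esub> h x)"

lemma (in ring) free_module_add_closed:
  "x \<in> carrier (free_module R n) \<Longrightarrow> y \<in> carrier (free_module R n) \<Longrightarrow>
     x \<oplus>\<^bsub>free_module R n\<^esub> y \<in> carrier (free_module R n)"
  unfolding free_module_simps(1,3) PiE_iff by simp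

lemma (in ring) free_module_smult_closed:
  "r \<in> carrier R \<Longrightarrow> x \<in> carrier (free_module R n) \<Longrightarrow>
     r \<odot>\<^bsub>free_module R n\<^esub> x \<in> carrier (free_module R n)"
  unfolding free_module_simps(1,4) PiE_iff by simp

lemma (in ring) unit_vec_closed: "unit_vec R n k \<in> carrier (free_module R n)"
  unfolding free_module_simps(1) unit_vec_def PiE_iff by simp

lemmas (in ring) free_module_closed =
  free_module_add_closed free_module_smult_closed unit_vec_closed

text \<open>Scalars act on the left, so a homomorphism multiplies row vectors by a matrix on the
  right. The induction adds to the truncation \<open>tr l\<close> of \<open>x\<close> one coordinate
  at a time.\<close>

lemma (in ring) free_module_hom_matrix:
  assumes h: "free_module_hom R m n h" and x: "x \<in> carrier (free_module R m)" and j: "j < n"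
  shows "h x j = (\<Oplus>i\<in>{..<m}. x i \<otimes> h (unit_vec R m i) j)"
proof -
  define tr where "tr l = (\<lambda>i \<in> {..<m}. if i < l then x i else \<zero>)" for l
  have tr: "tr l \<in> carrier (free_module R m)" for l
    using x unfolding tr_def free_module_simps(1) PiE_iff by simp
  have hc: "h y j \<in> carrier R" if "y \<in> carrier (free_module R m)" for y
  proof -
    have "h y \<in> {..<n} \<rightarrow>\<^sub>E carrier R"
      using h that unfolding free_module_hom_def free_module_simps(1) by blast
    then show ?thesis using j by (simp add: PiE_iff)
  qed
  have "l \<le> m \<Longrightarrow> h (tr l) j = (\<Oplus>i\<in>{..<l}. x i \<otimes> h (unit_vec R m i) j)" for l
  proof (induction l)
    case 0
    \<comment> \<open>\<open>tr 0\<close> is the zero vector. That \<open>h\<close> maps it to zero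
      has to be extracted from additivity at 0 + 0 = 0.\<close>
    have "tr 0 \<oplus>\<^bsub>free_module R m\<^esub> tr 0 = tr 0"
      unfolding tr_def free_module_simps(3) by (simp add: fun_eq_iff restrict_def)
    then have "h (tr 0) = h (tr 0) \<oplus>\<^bsub>free_module R n\<^esub> h (tr 0)"
      using h tr[of 0] by (metis free_module_hom_def)
    from fun_cong[OF this, of j] have "h (tr 0) j = h (tr 0) j \<oplus> h (tr 0) j"
      by (simp only: free_module_simps(3) lessThan_iff j restrict_apply if_True)
    then have "h (tr 0) j = \<zero>"
      using hc[OF tr[of 0]] add.l_cancel_one' by blast
    then show ?case by simp
  next
    case (Suc l)
    then have xl: "x l \<in> carrier R"
      using x by (simp add: free_module_simps(1) PiE_iff)
    have "tr (Suc l) = tr l \<oplus>\<^bsub>free_module R m\<^esub> (x l \<odot>\<^bsub>free_module R m\<^esub> unit_vec R m l)"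
      using x Suc.prems xl unfolding tr_def free_module_simps(1,3,4) unit_vec_def
      by (simp add: PiE_iff fun_eq_iff restrict_def less_Suc_eq)
    then have "h (tr (Suc l)) = h (tr l) \<oplus>\<^bsub>free_module R n\<^esub> (x l \<odot>\<^bsub>free_module R n\<^esub> h (unit_vec R m l))"
      using h tr[of l] free_module_closed xl by (simp add: free_module_hom_def)
    then have "h (tr (Suc l)) j = h (tr l) j \<oplus> (x l \<otimes> h (unit_vec R m l) j)"
      using j by (simp add: free_module_simps(3,4))
    also have "\<dots> = (\<Oplus>i\<in>{..<l}. x i \<otimes> h (unit_vec R m i) j) \<oplus> (x l \<otimes> h (unit_vec R m l) j)"
      using Suc by simp
    also have "\<dots> = (\<Oplus>i\<in>{..<Suc l}. x i \<otimes> h (unit_vec R m i) j)"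
    proof -
      have *: "x i \<otimes> h (unit_vec R m i) j \<in> carrier R" if "i \<le> l" for i
        using that Suc.prems x hc[OF free_module_closed(3)]
        by (simp add: free_module_simps(1) PiE_iff)
      show ?thesis
        unfolding lessThan_Suc
        using * by (subst finsum_insert) (auto intro!: a_comm finsum_closed)
    qed
    finally show ?case .
  qed
  moreover have "tr m = x"
    using x unfolding tr_def free_module_simps(1)
    by (simp add: PiE_iff fun_eq_iff restrict_def extensional_def)
  ultimately show ?thesis by (metis order_refl)
qed

text \<open>Row i of \<open>P\<close> is the image of the i-th unit vector under \<open>h\<close>,
  and \<open>Q\<close> is formed in the same way from the inverse \<open>g\<close>. Evaluating
  \<open>g\<close> after \<open>h\<close> and \<open>h\<close> after \<open>g\<close> at unit
  vectors gives the two products.\<close>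

lemma (in ring) module_iso_matrices:
  assumes h: "h \<in> module_isos R (free_module R m) (free_module R n)"
  obtains P Q where "\<And>i j. i < m \<Longrightarrow> j < n \<Longrightarrow> P i j \<in> carrier R"
    "\<And>i j. i < m \<Longrightarrow> j < n \<Longrightarrow> Q j i \<in> carrier R"
    "\<And>i k. i < m \<Longrightarrow> k < m \<Longrightarrow> (\<Oplus>j\<in>{..<n}. P i j \<otimes> Q j k) = (if k = i then \<one> else \<zero>)"
    "\<And>i k. i < n \<Longrightarrow> k < n \<Longrightarrow> (\<Oplus>j\<in>{..<m}. Q i j \<otimes> P j k) = (if k = i then \<one> else \<zero>)"
proof -
  let ?M = "free_module R m" and ?N = "free_module R n"
  define g where "g = inv_into (carrier ?M) h"
  have bij: "bij_betw h (carrier ?M) (carrier ?N)"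
    and hadd: "\<And>x y. x \<in> carrier ?M \<Longrightarrow> y \<in> carrier ?M \<Longrightarrow> h (x \<oplus>\<^bsub>?M\<^esub> y) = h x \<oplus>\<^bsub>?N\<^esub> h y"
    and hsm: "\<And>r x. r \<in> carrier R \<Longrightarrow> x \<in> carrier ?M \<Longrightarrow> h (r \<odot>\<^bsub>?M\<^esub> x) = r \<odot>\<^bsub>?N\<^esub> h x"
    using h by (auto simp: module_isos_def)
  have hc: "h x \<in> carrier ?N" if "x \<in> carrier ?M" for x
    using bij that by (rule bij_betwE[rule_format])
  have gc: "g y \<in> carrier ?M" and hg: "h (g y) = y" if "y \<in> carrier ?N" for y
    using that bij by (auto simp: g_def bij_betw_def inv_into_into f_inv_into_f)
  have gh: "g (h x) = x" if "x \<in> carrier ?M" for x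
    using that bij by (auto simp: g_def bij_betw_def)
  have "free_module_hom R m n h"
    using hc hadd hsm by (auto simp: free_module_hom_def)
  moreover have "free_module_hom R n m g"
    unfolding free_module_hom_def
  proof (intro conjI ballI Pi_I)
    fix x y assume "x \<in> carrier ?N" "y \<in> carrier ?N"
    then show "g (x \<oplus>\<^bsub>?N\<^esub> y) = g x \<oplus>\<^bsub>?M\<^esub> g y"
      by (metis gc hg gh hadd free_module_closed(1))
  next
    fix r x assume "r \<in> carrier R" "x \<in> carrier ?N"
    then show "g (r \<odot>\<^bsub>?N\<^esub> x) = r \<odot>\<^bsub>?M\<^esub> g x"
      by (metis gc hg gh hsm free_module_closed(2))
  qed (rule gc)
  moreover note free_module_hom_matrix
  ultimately have hm: "x \<in> carrier ?M \<Longrightarrow> j < n \<Longrightarrow> h x j = (\<Oplus>i\<in>{..<m}. x i \<otimes> h (unit_vec R m i) j)"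
    and gm: "y \<in> carrier ?N \<Longrightarrow> k < m \<Longrightarrow> g y k = (\<Oplus>i\<in>{..<n}. y i \<otimes> g (unit_vec R n i) k)"
    for x y j k by blast+
  show thesis
  proof (rule that[of "\<lambda>i j. h (unit_vec R m i) j" "\<lambda>j i. g (unit_vec R n j) i"])
    fix i j assume "i < m" "j < n"
    then show "h (unit_vec R m i) j \<in> carrier R" "g (unit_vec R n j) i \<in> carrier R"
      using hc[OF free_module_closed(3), of i] gc[OF free_module_closed(3), of j]
      by (simp_all add: free_module_simps(1) PiE_iff)
  next
    fix i k assume "i < m" "k < m"
    then show "(\<Oplus>j\<in>{..<n}. h (unit_vec R m i) j \<otimes> g (unit_vec R n j) k) = (if k = i then \<one> else \<zero>)"
      using gm[OF hc[OF free_module_closed(3)], of k i] gh[OF free_module_closed(3), of i]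
      by (simp add: unit_vec_def)
  next
    fix i k assume "i < n" "k < n"
    then show "(\<Oplus>j\<in>{..<m}. g (unit_vec R n i) j \<otimes> h (unit_vec R m j) k) = (if k = i then \<one> else \<zero>)"
      using hm[OF gc[OF free_module_closed(3)], of k i] hg[OF free_module_closed(3), of i]
      by (simp add: unit_vec_def)
  qed
qed

text \<open>The operators are linear on all functions, but the algebra laws are demanded on
  \<open>Fin X\<close> only. For the Leavitt path algebra the relation that makes the sum of the
  vertices equal to 1 fails off the points of the branching system, so there an operator may depend
  on the chosen representative of a class.\<close>

locale fin_rep = ring R for R :: "('a, 'b) ring_scheme" (structure) +
  fixes X :: "'x set" and \<rho> :: "'a \<Rightarrow> ('x \<Rightarrow> 'k::field) \<Rightarrow> 'x \<Rightarrow> 'k"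
  assumes rep_linear: "a \<in> carrier R \<Longrightarrow> Vector_Spaces.linear fscale fscale (\<rho> a)"
    and rep_closed: "a \<in> carrier R \<Longrightarrow> f \<in> Fin X \<Longrightarrow> \<rho> a f \<in> Fin X"
    and rep_add: "a \<in> carrier R \<Longrightarrow> b \<in> carrier R \<Longrightarrow> f \<in> Fin X \<Longrightarrow> \<rho> (a \<oplus> b) f = \<rho> a f + \<rho> b f"
    and rep_mult: "a \<in> carrier R \<Longrightarrow> b \<in> carrier R \<Longrightarrow> f \<in> Fin X \<Longrightarrow> \<rho> (a \<otimes> b) f = \<rho> a (\<rho> b f)"
    and rep_one: "f \<in> Fin X \<Longrightarrow> \<rho> \<one> f = f"
begin

lemma rep_zero: "f \<in> Fin X \<Longrightarrow> \<rho> \<zero> f = 0"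
  using rep_add[of \<zero> \<zero> f] by simp

lemma rep_finsum:
  assumes "finite J" "\<And>j. j \<in> J \<Longrightarrow> a j \<in> carrier R" "f \<in> Fin X"
  shows "\<rho> (\<Oplus>j\<in>J. a j) f = (\<Sum>j\<in>J. \<rho> (a j) f)"
  using assms
proof (induction J)
  case empty
  then show ?case by (simp add: rep_zero)
next
  case (insert j J)
  then show ?case
    by (subst finsum_insert) (auto simp: rep_add finsum_closed)
qed

lemma rep_sum:
  assumes "a \<in> carrier R"
  shows "\<rho> a (\<Sum>j\<in>J. f j) = (\<Sum>j\<in>J. \<rho> a (f j))"
proof -
  interpret Vector_Spaces.linear fscale fscale "\<rho> a"
    by (rule rep_linear assms)+
  show ?thesis by (rule sum)
qed

text \<open>The operator on \<open>m\<close>-tuples of functions given by a matrix \<open>Q\<close> with \<open>n\<close> rows and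
  \<open>m\<close> columns; a tuple is stored as one function on pairs.\<close>

definition mat_op :: "nat \<Rightarrow> nat \<Rightarrow> (nat \<Rightarrow> nat \<Rightarrow> 'a) \<Rightarrow> (nat \<times> 'x \<Rightarrow> 'k) \<Rightarrow> nat \<times> 'x \<Rightarrow> 'k" where
  "mat_op n m Q f = (\<lambda>(j, x). if j < n then (\<Sum>k<m. \<rho> (Q j k) (\<lambda>y. f (k, y))) x else 0)"

lemma slice_Fin: "f \<in> Fin ({..<m} \<times> X) \<Longrightarrow> (\<lambda>y. f (k, y)) \<in> Fin X"
proof -
  assume f: "f \<in> Fin ({..<m} \<times> X)"
  then have "finite (Pair k -` {z. f z \<noteq> 0})"
    by (intro finite_vimageI) (auto simp: Fin_def inj_on_def)
  then show ?thesis
    using f by (auto simp: Fin_def vimage_def)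
qed

lemma Fin_sum: "(\<And>j. j \<in> J \<Longrightarrow> f j \<in> Fin X) \<Longrightarrow> (\<Sum>j\<in>J. f j) \<in> Fin X"
  by (rule fv.subspace_sum[OF Fin_subspace])

lemma mat_op_Fin:
  assumes Q: "\<And>j k. j < n \<Longrightarrow> k < m \<Longrightarrow> Q j k \<in> carrier R" and f: "f \<in> Fin ({..<m} \<times> X)"
  shows "mat_op n m Q f \<in> Fin ({..<n} \<times> X)"
proof -
  let ?F = "\<lambda>j. \<Sum>k<m. \<rho> (Q j k) (\<lambda>y. f (k, y))"
  have F: "?F j \<in> Fin X" if "j < n" for j
    using that by (intro Fin_sum rep_closed Q slice_Fin[OF f]) auto
  have "{z. mat_op n m Q f z \<noteq> 0} \<subseteq> (SIGMA j:{..<n}. {x. ?F j x \<noteq> 0})"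
    by (auto simp: mat_op_def split: if_splits)
  moreover have "finite (SIGMA j:{..<n}. {x. ?F j x \<noteq> 0})"
    using F by (intro finite_SigmaI) (auto simp: Fin_def)
  moreover have "(SIGMA j:{..<n}. {x. ?F j x \<noteq> 0}) \<subseteq> {..<n} \<times> X"
    using F by (auto simp: Fin_def)
  ultimately show ?thesis
    unfolding Fin_def by (blast intro: finite_subset)
qed

lemma mat_op_linear:
  assumes Q: "\<And>j k. j < n \<Longrightarrow> k < m \<Longrightarrow> Q j k \<in> carrier R"
  shows "Vector_Spaces.linear fscale fscale (mat_op n m Q)"
proof -
  have add: "\<rho> (Q j k) (f + g) = \<rho> (Q j k) f + \<rho> (Q j k) g"
    and scale: "\<rho> (Q j k) (fscale c f) = fscale c (\<rho> (Q j k) f)"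
    if "j < n" "k < m" for j k c f g
    using rep_linear[OF Q[OF that]]
    by (auto simp: Vector_Spaces.linear_def module_hom_def module_hom_axioms_def)
  have "mat_op n m Q (f + g) (j, x) = (mat_op n m Q f + mat_op n m Q g) (j, x)"
    and "mat_op n m Q (fscale c f) (j, x) = fscale c (mat_op n m Q f) (j, x)" for f g c j x
  proof -
    have eta: "(\<lambda>y. (f + g) (k, y)) = (\<lambda>y. f (k, y)) + (\<lambda>y. g (k, y))"
      "(\<lambda>y. fscale c f (k, y)) = fscale c (\<lambda>y. f (k, y))" for k
      by (auto simp: fscale_apply)
    have "\<rho> (Q j k) (\<lambda>y. (f + g) (k, y)) = \<rho> (Q j k) (\<lambda>y. f (k, y)) + \<rho> (Q j k) (\<lambda>y. g (k, y))"
      "\<rho> (Q j k) (\<lambda>y. fscale c f (k, y)) = fscale c (\<rho> (Q j k) (\<lambda>y. f (k, y)))"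
      if "j < n" "k < m" for k
      unfolding eta using that by (rule add scale)+
    then show "mat_op n m Q (f + g) (j, x) = (mat_op n m Q f + mat_op n m Q g) (j, x)"
      "mat_op n m Q (fscale c f) (j, x) = fscale c (mat_op n m Q f) (j, x)"
      by (simp_all add: mat_op_def sum.distrib fscale_apply sum_fun_apply sum_distrib_left
        del: plus_fun_apply) (simp add: sum_fun_apply sum.distrib flip: sum.distrib)
  qed
  then show ?thesis
    by unfold_locales auto
qed

text \<open>Exchanging the two sums produces the entries of the matrix product. At indices i \<ge> m
  both sides vanish, one by the default value in \<open>mat_op\<close>, the other by the support of
  \<open>f\<close>.\<close>

lemma mat_op_comp:
  assumes P: "\<And>i j. i < m \<Longrightarrow> j < n \<Longrightarrow> P i j \<in> carrier R"
    and Q: "\<And>j k. j < n \<Longrightarrow> k < m \<Longrightarrow> Q j k \<in> carrier R"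
    and PQ: "\<And>i k. i < m \<Longrightarrow> k < m \<Longrightarrow> (\<Oplus>j\<in>{..<n}. P i j \<otimes> Q j k) = (if k = i then \<one> else \<zero>)"
    and f: "f \<in> Fin ({..<m} \<times> X)"
  shows "mat_op m n P (mat_op n m Q f) = f"
proof -
  note sl = slice_Fin[OF f]
  have "mat_op m n P (mat_op n m Q f) (i, x) = f (i, x)" for i x
  proof (cases "i < m")
    case True
    have "(\<Sum>j<n. \<rho> (P i j) (\<lambda>y. mat_op n m Q f (j, y)))
        = (\<Sum>j<n. \<rho> (P i j) (\<Sum>k<m. \<rho> (Q j k) (\<lambda>y. f (k, y))))"
      by (intro sum.cong arg_cong[where f = "\<rho> _"]) (auto simp: mat_op_def)
    also have "\<dots> = (\<Sum>j<n. \<Sum>k<m. \<rho> (P i j \<otimes> Q j k) (\<lambda>y. f (k, y)))"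
      using True by (intro sum.cong refl) (auto simp: rep_sum rep_mult P Q sl)
    also have "\<dots> = (\<Sum>k<m. \<Sum>j<n. \<rho> (P i j \<otimes> Q j k) (\<lambda>y. f (k, y)))"
      by (rule sum.swap)
    also have "\<dots> = (\<Sum>k<m. \<rho> (\<Oplus>j\<in>{..<n}. P i j \<otimes> Q j k) (\<lambda>y. f (k, y)))"
      using True by (intro sum.cong refl rep_finsum[symmetric]) (auto simp: P Q sl)
    also have "\<dots> = (\<Sum>k<m. if k = i then (\<lambda>y. f (k, y)) else 0)"
      using True by (intro sum.cong refl) (auto simp: PQ rep_one rep_zero sl)
    also have "\<dots> = (\<lambda>y. f (i, y))"
      using True by simp
    finally show ?thesis
      using True by (simp add: mat_op_def)
  next
    case False
    then show ?thesis
      using f by (auto simp: mat_op_def Fin_def)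
  qed
  then show ?thesis by auto
qed

lemma mat_op_delta:
  assumes "k < m" "\<And>j k. j < n \<Longrightarrow> k < m \<Longrightarrow> Q j k \<in> carrier R"
  shows "mat_op n m Q (delta (k, x)) = (\<lambda>(j, z). if j < n then \<rho> (Q j k) (delta x) z else 0)"
proof -
  have "(\<Sum>l<m. \<rho> (Q j l) (\<lambda>y. delta (k, x) (l, y))) = \<rho> (Q j k) (delta x)" if "j < n" for j
  proof -
    have "(\<Sum>l<m. \<rho> (Q j l) (\<lambda>y. delta (k, x) (l, y))) = (\<Sum>l<m. if l = k then \<rho> (Q j k) (delta x) else 0)"
    proof (rule sum.cong[OF refl])
      fix l assume "l \<in> {..<m}"
      then have "\<rho> (Q j l) 0 = 0"
        using rep_sum[of "Q j l" "\<lambda>_. 0" "{}"] assms that by simp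
      moreover have "(\<lambda>y. delta (k, x) (l, y) :: 'k) = (if l = k then delta x else 0)"
        by (auto simp: delta_def)
      ultimately show "\<rho> (Q j l) (\<lambda>y. delta (k, x) (l, y)) = (if l = k then \<rho> (Q j k) (delta x) else 0)"
        by simp
    qed
    then show ?thesis using assms(1) by simp
  qed
  then show ?thesis by (auto simp: mat_op_def)
qed

lemma mat_op_bij:
  assumes P: "\<And>i j. i < m \<Longrightarrow> j < n \<Longrightarrow> P i j \<in> carrier R"
    and Q: "\<And>i j. i < m \<Longrightarrow> j < n \<Longrightarrow> Q j i \<in> carrier R"
    and PQ: "\<And>i k. i < m \<Longrightarrow> k < m \<Longrightarrow> (\<Oplus>j\<in>{..<n}. P i j \<otimes> Q j k) = (if k = i then \<one> else \<zero>)"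
    and QP: "\<And>i k. i < n \<Longrightarrow> k < n \<Longrightarrow> (\<Oplus>j\<in>{..<m}. Q i j \<otimes> P j k) = (if k = i then \<one> else \<zero>)"
  shows "bij_betw (mat_op n m Q) (Fin ({..<m} \<times> X)) (Fin ({..<n} \<times> X))"
  by (rule bij_betw_byWitness[where f' = "mat_op m n P"])
    (use mat_op_comp[of m n P Q] mat_op_comp[of n m Q P] mat_op_Fin[of m n P] mat_op_Fin[of n m Q] assms
      in blast)+

end

text \<open>\<open>Q\<close> has finitely many entries, so the set \<open>D\<close> of points at
  which some entry acts differently in the two representations is finite. With s =
  \<open>card (X' - X)\<close>, the index formula for the action of \<open>Q\<close> on tuples,
  compared on \<open>{..<m} \<times> (X - D)\<close>, reads m |D| + n s = m (|D| + s), and s is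
  positive because \<open>X\<close> is a proper subset of \<open>X'\<close>.\<close>

theorem IBN_criterion:
  fixes R :: "('a, 'b) ring_scheme" and X X' :: "'x set" and \<rho> \<rho>' :: "'a \<Rightarrow> ('x \<Rightarrow> 'k::field) \<Rightarrow> 'x \<Rightarrow> 'k"
  assumes "fin_rep R X \<rho>" "fin_rep R X' \<rho>'"
    and X: "X \<subseteq> X'" "finite (X' - X)" "X \<noteq> X'"
    and agree: "\<And>a. a \<in> carrier R \<Longrightarrow> finite {x \<in> X. \<rho> a (delta x) \<noteq> \<rho>' a (delta x)}"
  shows "IBN R"
  unfolding IBN_def
proof (intro allI impI)
  interpret A: fin_rep R X \<rho> by fact
  interpret B: fin_rep R X' \<rho>' by fact
  fix m n assume "module_isos R (free_module R m) (free_module R n) \<noteq> {}"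
  then obtain h where h: "h \<in> module_isos R (free_module R m) (free_module R n)" by blast
  obtain P Q where PQ: "\<And>i j. i < m \<Longrightarrow> j < n \<Longrightarrow> P i j \<in> carrier R"
    "\<And>i j. i < m \<Longrightarrow> j < n \<Longrightarrow> Q j i \<in> carrier R"
    "\<And>i k. i < m \<Longrightarrow> k < m \<Longrightarrow> (\<Oplus>\<^bsub>R\<^esub>j\<in>{..<n}. P i j \<otimes>\<^bsub>R\<^esub> Q j k) = (if k = i then \<one>\<^bsub>R\<^esub> else \<zero>\<^bsub>R\<^esub>)"
    "\<And>i k. i < n \<Longrightarrow> k < n \<Longrightarrow> (\<Oplus>\<^bsub>R\<^esub>j\<in>{..<m}. Q i j \<otimes>\<^bsub>R\<^esub> P j k) = (if k = i then \<one>\<^bsub>R\<^esub> else \<zero>\<^bsub>R\<^esub>)"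
    by (rule A.module_iso_matrices[OF h]) blast
  define D where "D = (\<Union>j<n. \<Union>k<m. {x \<in> X. \<rho> (Q j k) (delta x) \<noteq> \<rho>' (Q j k) (delta x)})"
  have D: "finite D" "D \<subseteq> X"
    unfolding D_def using agree PQ(2) by auto
  have eq1: "{..<m} \<times> X - {..<m} \<times> (X - D) = {..<m} \<times> D"
    and eq2: "{..<m} \<times> X' - {..<m} \<times> (X - D) = {..<m} \<times> (D \<union> (X' - X))"
    and eq3: "{..<n} \<times> X' - {..<n} \<times> X = {..<n} \<times> (X' - X)"
    using X D by auto
  have "card ({..<m} \<times> X - {..<m} \<times> (X - D)) + card ({..<n} \<times> X' - {..<n} \<times> X)
      = card ({..<m} \<times> X' - {..<m} \<times> (X - D))"
  proof (rule index_formula)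
    show "bij_betw (A.mat_op n m Q) (Fin ({..<m} \<times> X)) (Fin ({..<n} \<times> X))"
      by (rule A.mat_op_bij[OF PQ])
    show "bij_betw (B.mat_op n m Q) (Fin ({..<m} \<times> X')) (Fin ({..<n} \<times> X'))"
      by (rule B.mat_op_bij[OF PQ])
    show "Vector_Spaces.linear fscale fscale (A.mat_op n m Q)"
      by (rule A.mat_op_linear) (rule PQ(2))
    show "Vector_Spaces.linear fscale fscale (B.mat_op n m Q)"
      by (rule B.mat_op_linear) (rule PQ(2))
    fix y assume "y \<in> {..<m} \<times> (X - D)"
    then obtain k x where y: "y = (k, x)" "k < m" "x \<in> X" "x \<notin> D" by auto
    then have "\<rho> (Q j k) (delta x) = \<rho>' (Q j k) (delta x)" if "j < n" for j
      using that by (auto simp: D_def)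
    then show "A.mat_op n m Q (delta y) = B.mat_op n m Q (delta y)"
      using y PQ(2) by (simp add: A.mat_op_delta B.mat_op_delta fun_eq_iff)
  qed (unfold eq1 eq2 eq3, use X D in auto)
  moreover have "card (D \<union> (X' - X)) = card D + card (X' - X)"
    using D X by (intro card_Un_disjoint) auto
  ultimately have "n * card (X' - X) = m * card (X' - X)"
    by (simp add: eq1 eq2 eq3 card_cartesian_product algebra_simps)
  moreover have "card (X' - X) \<noteq> 0"
    using X by auto
  ultimately show "m = n" by simp
qed

section \<open>Words acting by partial maps\<close>

primrec run :: "('g \<Rightarrow> 'x \<Rightarrow> 'x option) \<Rightarrow> 'g list \<Rightarrow> 'x \<Rightarrow> 'x option" where
  "run \<tau> [] x = Some x"
| "run \<tau> (g # w) x = Option.bind (\<tau> g x) (run \<tau> w)"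

lemma run_append: "run \<tau> (u @ w) x = Option.bind (run \<tau> u x) (run \<tau> w)"
  by (induction u arbitrary: x) (simp_all split: option.split bind_splits)

text \<open>Composition with a partial map, extended by zero. Pulling back reverses composition, so
  \<open>run\<close> follows a word from left to right and the resulting \<open>act\<close> is
  nevertheless a left action.\<close>

definition pull :: "('x \<Rightarrow> 'x option) \<Rightarrow> ('x \<Rightarrow> 'k::field) \<Rightarrow> 'x \<Rightarrow> 'k" where
  "pull t f = (\<lambda>x. case t x of None \<Rightarrow> 0 | Some y \<Rightarrow> f y)"

lemma pull_simps:
  "pull t (f + g) = pull t f + pull t g"
  "pull t 0 = 0"
  "pull t (fscale c f) = fscale c (pull t f)"
  "pull t (pull s f) = pull (\<lambda>x. Option.bind (t x) s) f"
  by (auto simp: pull_def fscale_apply fun_eq_iff split: option.split)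

definition act :: "('g \<Rightarrow> 'x \<Rightarrow> 'x option) \<Rightarrow> ('g, 'k::field) ncpoly \<Rightarrow> ('x \<Rightarrow> 'k) \<Rightarrow> 'x \<Rightarrow> 'k" where
  "act \<tau> p f = (\<Sum>w\<in>Poly_Mapping.keys p. fscale (Poly_Mapping.lookup p w) (pull (run \<tau> (letters w)) f))"

lemma act_superset:
  assumes "finite S" "Poly_Mapping.keys p \<subseteq> S"
  shows "act \<tau> p f = (\<Sum>w\<in>S. fscale (Poly_Mapping.lookup p w) (pull (run \<tau> (letters w)) f))"
  unfolding act_def using assms
  by (intro sum.mono_neutral_left) (auto simp: in_keys_iff fscale_def fun_eq_iff)

lemma act_add: "act \<tau> (p + q) f = act \<tau> p f + act \<tau> q f"
proof -
  let ?S = "Poly_Mapping.keys p \<union> Poly_Mapping.keys q"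
  have "Poly_Mapping.keys (p + q) \<subseteq> ?S" by (rule keys_add)
  then show ?thesis
    by (simp add: act_superset[of ?S] lookup_add fv.scale_left_distrib sum.distrib)
qed

lemma act_zero [simp]: "act \<tau> 0 f = 0"
  by (simp add: act_def)

lemma act_uminus: "act \<tau> (- p) f = - act \<tau> p f"
  using act_add[of \<tau> p "- p" f] by (simp add: eq_neg_iff_add_eq_0 add.commute)

lemma act_diff: "act \<tau> (p - q) f = act \<tau> p f - act \<tau> q f"
  using act_add[of \<tau> p "- q" f] by (simp add: act_uminus)

lemma act_sum: "act \<tau> (\<Sum>i\<in>I. p i) f = (\<Sum>i\<in>I. act \<tau> (p i) f)"
  by (induction I rule: infinite_finite_induct) (simp_all add: act_add)

lemma act_single: "act \<tau> (Poly_Mapping.single w c) f = fscale c (pull (run \<tau> (letters w)) f)"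
  by (simp add: act_superset[of "{w}"])

lemma act_ncvar: "act \<tau> (ncvar g) f = pull (\<tau> g) f"
proof -
  have "run \<tau> [g] = \<tau> g"
    by (auto simp: fun_eq_iff split: bind_splits)
  then show ?thesis by (simp add: ncvar_def act_single del: run.simps)
qed

lemma act_one: "act \<tau> 1 f = f"
  by (simp add: act_single pull_def fun_eq_iff fscale_apply flip: single_one)

lemma act_linear:
  "act \<tau> p (f + g) = act \<tau> p f + act \<tau> p g"
  "act \<tau> p (fscale c f) = fscale c (act \<tau> p f)"
  by (simp_all add: act_def pull_simps fv.scale_right_distrib sum.distrib fv.scale_sum_right mult.commute)

lemma act_Vector_Spaces_linear: "Vector_Spaces.linear fscale fscale (act \<tau> p)"
  by unfold_locales (simp_all add: act_linear)

lemma act_fun_zero [simp]: "act \<tau> p 0 = 0"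
  by (simp add: act_def pull_simps)

lemma ncpoly_induct [case_names zero single add]:
  fixes p :: "('g, 'k::field) ncpoly"
  assumes "P 0" "\<And>w c. P (Poly_Mapping.single w c)" "\<And>p q. P p \<Longrightarrow> P q \<Longrightarrow> P (p + q)"
  shows "P p"
proof (induction p rule: update_induct)
  case (update p w c)
  then have "Poly_Mapping.update w c p = p + Poly_Mapping.single w c"
    by (intro poly_mapping_eqI) (auto simp: lookup_update lookup_add lookup_single in_keys_iff when_def)
  then show ?case using update assms by simp
qed (rule assms)

lemma act_mult: "act \<tau> (p * q) f = act \<tau> p (act \<tau> q f)"
proof (induction p rule: ncpoly_induct)
  case (single w c)
  show ?case
  proof (induction q rule: ncpoly_induct)
    case (single w' c')
    have "run \<tau> (letters w @ letters w') = (\<lambda>x. Option.bind (run \<tau> (letters w) x) (run \<tau> (letters w')))"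
      by (simp add: run_append fun_eq_iff)
    then show ?case
      by (simp add: mult_single act_single pull_simps)
  qed (simp_all add: act_add act_linear distrib_left del: plus_fun_apply zero_fun_apply)
qed (simp_all add: act_add distrib_right del: plus_fun_apply zero_fun_apply)

text \<open>Only the fibres of a word over the support of \<open>f\<close> can meet the support of
  the pullback; hence the conditions that fibres be finite and that \<open>X\<close> contain the
  fibres over its points.\<close>

lemma act_Fin:
  assumes fin: "\<And>w y. set w \<subseteq> A \<Longrightarrow> finite {x. run \<tau> w x = Some y}"
    and X: "\<And>w x y. set w \<subseteq> A \<Longrightarrow> y \<in> X \<Longrightarrow> run \<tau> w x = Some y \<Longrightarrow> x \<in> X"
    and p: "\<And>w. w \<in> Poly_Mapping.keys p \<Longrightarrow> set (letters w) \<subseteq> A"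
    and f: "f \<in> Fin X"
  shows "act \<tau> p f \<in> Fin X"
proof -
  have "pull (run \<tau> w) f \<in> Fin X" if w: "set w \<subseteq> A" for w
  proof -
    have "{x. pull (run \<tau> w) f x \<noteq> 0} \<subseteq> (\<Union>y\<in>{y. f y \<noteq> 0}. {x. run \<tau> w x = Some y})"
      by (auto simp: pull_def split: option.splits)
    moreover have "finite (\<Union>y\<in>{y. f y \<noteq> 0}. {x. run \<tau> w x = Some y})"
      using f fin[OF w] by (auto simp: Fin_def)
    moreover have "(\<Union>y\<in>{y. f y \<noteq> 0}. {x. run \<tau> w x = Some y}) \<subseteq> X"
      using f X[OF w] by (auto simp: Fin_def)
    ultimately show ?thesis
      unfolding Fin_def by (blast intro: finite_subset)
  qed
  then show ?thesis
    unfolding act_def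
    by (intro fv.subspace_sum[OF Fin_subspace] fv.subspace_scale[OF Fin_subspace]) (use p in auto)
qed

section \<open>Consequences of the Leavitt relations in a target ring\<close>

lemma ncconst_mult: "ncconst (a * b) = ncconst a * ncconst b"
  by (simp add: ncconst_def mult_single)

lemma ncconst_add: "ncconst (a + b) = ncconst a + ncconst b"
  by (simp add: ncconst_def single_add)

lemma ncconst_one: "ncconst 1 = 1"
  by (simp add: ncconst_def)

lemma ncconst_zero: "ncconst 0 = 0"
  by (simp add: ncconst_def)

lemma ncconst_central: "ncconst c * p = p * ncconst c"
  by (induction p rule: ncpoly_induct)
    (simp_all add: ncconst_def mult_single distrib_left distrib_right mult.commute)

text \<open>The target is left arbitrary so that every consequence of the relations is available
  both in the Leavitt path algebra itself and in each of its quotients.\<close>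

locale leavitt_hom = fin_digraph G + B: ring B
  for G :: "('v, 'e) pre_digraph" and B :: "('b, 'm) ring_scheme" (structure) +
  fixes h :: "(('v, 'e) leavitt_gen, 'k::field) ncpoly \<Rightarrow> 'b"
  assumes hom: "h \<in> ring_hom (free_algebra TYPE('k) (leavitt_gens G)) B"
    and rels: "r \<in> leavitt_rels TYPE('k) G \<Longrightarrow> h r = \<zero>"
begin

abbreviation "FA \<equiv> carrier (free_algebra TYPE('k) (leavitt_gens G))"

lemma h_closed: "p \<in> FA \<Longrightarrow> h p \<in> carrier B"
  using hom by (rule ring_hom_closed)

lemma h_add: "p \<in> FA \<Longrightarrow> q \<in> FA \<Longrightarrow> h (p + q) = h p \<oplus> h q"
  using ring_hom_add[OF hom, of p q] by (simp add: free_algebra_def)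

lemma h_mult: "p \<in> FA \<Longrightarrow> q \<in> FA \<Longrightarrow> h (p * q) = h p \<otimes> h q"
  using ring_hom_mult[OF hom, of p q] by (simp add: free_algebra_def)

lemma h_one: "h 1 = \<one>"
  using ring_hom_one[OF hom] by (simp add: free_algebra_def)

lemma h_zero: "h 0 = \<zero>"
  using ring_hom_zero[OF hom free_algebra_ring B.ring_axioms] by (simp add: free_algebra_def)

lemma h_diff_eq: "p \<in> FA \<Longrightarrow> q \<in> FA \<Longrightarrow> h (p - q) = \<zero> \<Longrightarrow> h p = h q"
  using h_add[of "p - q" q] free_algebra_closed(4)[of p "leavitt_gens G" q] h_closed[of q]
  by simp

lemma h_sum: "(\<And>i. i \<in> I \<Longrightarrow> p i \<in> FA) \<Longrightarrow> finite I \<Longrightarrow> h (\<Sum>i\<in>I. p i) = (\<Oplus>i\<in>I. h (p i))"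
proof (induction I rule: infinite_finite_induct)
  case (insert i I)
  then have "h (\<Sum>i\<in>insert i I. p i) = h (p i) \<oplus> h (\<Sum>i\<in>I. p i)"
    by (simp add: h_add free_algebra_closed(8))
  with insert show ?case
    by (subst B.finsum_insert) (auto simp: h_closed)
qed (simp_all add: h_zero)

abbreviation "\<nu> v \<equiv> h (ncvar (Vert v))"
abbreviation "\<alpha> e \<equiv> h (ncvar (Arc e))"
abbreviation "\<gamma> e \<equiv> h (ncvar (Ghost e))"

lemma gen_in_FA [simp]:
  "v \<in> verts G \<Longrightarrow> ncvar (Vert v) \<in> FA" "e \<in> arcs G \<Longrightarrow> ncvar (Arc e) \<in> FA"
  "e \<in> arcs G \<Longrightarrow> ncvar (Ghost e) \<in> FA"
  by (auto intro!: free_algebra_closed simp: leavitt_gens_def)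

lemma gen_closed [simp]:
  "v \<in> verts G \<Longrightarrow> \<nu> v \<in> carrier B" "e \<in> arcs G \<Longrightarrow> \<alpha> e \<in> carrier B"
  "e \<in> arcs G \<Longrightarrow> \<gamma> e \<in> carrier B"
  by (auto intro!: h_closed)

lemma h_rel_eq: "p - q \<in> leavitt_rels TYPE('k) G \<Longrightarrow> p \<in> FA \<Longrightarrow> q \<in> FA \<Longrightarrow> h p = h q"
  by (intro h_diff_eq rels)

lemma vert_vert:
  assumes "v \<in> verts G" "w \<in> verts G"
  shows "\<nu> v \<otimes> \<nu> w = (if v = w then \<nu> v else \<zero>)"
proof -
  have "h (ncvar (Vert v) * ncvar (Vert w)) = h (if v = w then ncvar (Vert v) else 0)"
    by (rule h_rel_eq) (use assms in \<open>auto simp: leavitt_rels_def intro!: free_algebra_closed gen_in_FA\<close>)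
  then show ?thesis
    using assms by (simp add: h_mult h_zero split: if_splits)
qed

lemma src_gen:
  assumes "x \<in> Arc ` arcs G \<union> Ghost ` arcs G"
  shows "\<nu> (gen_src G x) \<otimes> h (ncvar x) = h (ncvar x)"
proof -
  have x: "ncvar x \<in> FA" "gen_src G x \<in> verts G" using assms by auto
  have "h (ncvar (Vert (gen_src G x)) * ncvar x) = h (ncvar x)"
    by (rule h_rel_eq) (use assms x in \<open>auto simp: leavitt_rels_def intro!: free_algebra_closed gen_in_FA\<close>)
  then show ?thesis
    using x by (simp add: h_mult)
qed

lemma gen_tgt:
  assumes "x \<in> Arc ` arcs G \<union> Ghost ` arcs G"
  shows "h (ncvar x) \<otimes> \<nu> (gen_tgt G x) = h (ncvar x)"
proof -
  have x: "ncvar x \<in> FA" "gen_tgt G x \<in> verts G" using assms by auto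
  have "h (ncvar x * ncvar (Vert (gen_tgt G x))) = h (ncvar x)"
    by (rule h_rel_eq) (use assms x in \<open>auto simp: leavitt_rels_def intro!: free_algebra_closed gen_in_FA\<close>)
  then show ?thesis
    using x by (simp add: h_mult)
qed

lemma arc_simps:
  assumes "e \<in> arcs G"
  shows "\<nu> (tail G e) \<otimes> \<alpha> e = \<alpha> e" "\<alpha> e \<otimes> \<nu> (head G e) = \<alpha> e"
    "\<nu> (head G e) \<otimes> \<gamma> e = \<gamma> e" "\<gamma> e \<otimes> \<nu> (tail G e) = \<gamma> e"
  using src_gen[of "Arc e"] src_gen[of "Ghost e"] gen_tgt[of "Arc e"] gen_tgt[of "Ghost e"] assms
  by simp_all

lemma ghost_arc:
  assumes "e \<in> arcs G" "f \<in> arcs G"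
  shows "\<gamma> e \<otimes> \<alpha> f = (if e = f then \<nu> (head G e) else \<zero>)"
proof -
  have "h (ncvar (Ghost e) * ncvar (Arc f)) = h (if e = f then ncvar (Vert (head G e)) else 0)"
    by (rule h_rel_eq) (use assms in \<open>auto simp: leavitt_rels_def intro!: free_algebra_closed gen_in_FA\<close>)
  then show ?thesis
    using assms by (simp add: h_mult h_zero split: if_splits)
qed

lemma one_eq_sum_verts: "\<one> = (\<Oplus>v\<in>verts G. \<nu> v)"
proof -
  have "h 1 = h (\<Sum>v\<in>verts G. ncvar (Vert v))"
    by (rule h_rel_eq) (auto simp: leavitt_rels_def intro!: free_algebra_closed gen_in_FA)
  then show ?thesis
    by (simp add: h_one h_sum)
qed

definition "\<kappa> c = h (ncconst c)"

lemma kappa_closed [simp]: "\<kappa> c \<in> carrier B"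
  by (simp add: \<kappa>_def h_closed free_algebra_closed)

lemma kappa_simps:
  "\<kappa> (a + b) = \<kappa> a \<oplus> \<kappa> b" "\<kappa> (a * b) = \<kappa> a \<otimes> \<kappa> b" "\<kappa> 1 = \<one>" "\<kappa> 0 = \<zero>"
  by (simp_all add: \<kappa>_def ncconst_add ncconst_mult ncconst_one ncconst_zero h_add h_mult h_one h_zero
      free_algebra_closed)

lemma kappa_uminus: "\<kappa> (- a) = \<ominus> \<kappa> a"
  using kappa_simps(1)[of "- a" a] by (intro B.minus_equality[symmetric]) (simp_all add: kappa_simps)

lemma kappa_central: "p \<in> FA \<Longrightarrow> \<kappa> c \<otimes> h p = h p \<otimes> \<kappa> c"
  unfolding \<kappa>_def by (simp add: ncconst_central free_algebra_closed flip: h_mult)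

lemma kappa_inj: "\<one> \<noteq> \<zero> \<Longrightarrow> inj \<kappa>"
proof (rule injI, rule ccontr)
  fix a b assume "\<one> \<noteq> \<zero>" "\<kappa> a = \<kappa> b" "a \<noteq> b"
  then have "\<kappa> (a - b) = \<zero>"
    using kappa_simps(1)[of a "- b"] by (simp add: kappa_uminus B.r_neg)
  then have "\<kappa> (inverse (a - b) * (a - b)) = \<zero>"
    by (simp add: kappa_simps)
  then show False
    using \<open>a \<noteq> b\<close> \<open>\<one> \<noteq> \<zero>\<close> by (simp add: kappa_simps)
qed

lemma kappa_subfield:
  assumes one: "\<one> \<noteq> \<zero>"
  shows "subfield (range \<kappa>) B"
proof (rule B.subfieldI)
  show "subcring (range \<kappa>) B"
    by (rule B.subcringI, rule B.subringI)
      (auto simp: mult.commute simp flip: kappa_simps kappa_uminus)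
  have "\<kappa> c \<in> Units (B\<lparr>carrier := range \<kappa>\<rparr>)" if "\<kappa> c \<noteq> \<zero>" for c
  proof -
    from that have "c \<noteq> 0" by (auto simp: kappa_simps)
    then have "\<kappa> c \<otimes> \<kappa> (inverse c) = \<one>" "\<kappa> (inverse c) \<otimes> \<kappa> c = \<one>"
      by (simp_all flip: kappa_simps)
    then show ?thesis by (auto simp: Units_def)
  qed
  moreover have "\<zero> \<notin> Units (B\<lparr>carrier := range \<kappa>\<rparr>)"
    using one by (auto simp: Units_def)
  moreover have "Units (B\<lparr>carrier := range \<kappa>\<rparr>) \<subseteq> range \<kappa>"
    by (auto simp: Units_def)
  ultimately show "Units (B\<lparr>carrier := range \<kappa>\<rparr>) = range \<kappa> - {\<zero>}"
    by blast
qed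

end

section \<open>Exponential growth from two returning arcs\<close>

text \<open>In a linear combination the scalars stand on the left, so right multiplication by
  \<open>d\<close> passes through it.\<close>

lemma (in ring) Span_annihilated:
  assumes K: "K \<subseteq> carrier R" and Us: "set Us \<subseteq> carrier R" and d: "d \<in> carrier R"
    and zero: "\<And>u. u \<in> set Us \<Longrightarrow> u \<otimes> d = \<zero>" and z: "z \<in> Span K Us"
  shows "z \<otimes> d = \<zero>"
  using Us zero z
proof (induction Us arbitrary: z)
  case Nil
  then show ?case using d by simp
next
  case (Cons u Us)
  then obtain k v where kv: "k \<in> K" "v \<in> Span K Us" "z = k \<otimes> u \<oplus> v"
    by (auto simp: line_extension_mem_iff)
  then have "v \<in> carrier R" "k \<in> carrier R"
    using K Cons.prems Span_in_carrier[of K Us] by auto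
  then have "z \<otimes> d = k \<otimes> (u \<otimes> d) \<oplus> v \<otimes> d"
    using Cons.prems d by (simp add: kv l_distr m_assoc)
  then show ?case
    using Cons kv \<open>k \<in> carrier R\<close> by simp
qed

text \<open>The order is reversed: when a word is multiplied by its dual, the last letter meets its
  own dual first and the cancellation proceeds outward.\<close>

primrec (in ring) dual_prod :: "('a \<Rightarrow> 'a) \<Rightarrow> 'a list \<Rightarrow> 'a" where
  "dual_prod d [] = \<one>"
| "dual_prod d (g # w) = dual_prod d w \<otimes> d g"

text \<open>Words of a fixed length in two left inverses \<open>a\<close>, \<open>b\<close> of \<open>x\<close>, \<open>y\<close> relative to the
  idempotent \<open>u\<close> are separated by right multiplication with the dual words in \<open>x\<close>, \<open>y\<close>.\<close>

locale leavitt_pair = ring R for R :: "('a, 'b) ring_scheme" (structure) +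
  fixes a b x y u
  assumes closed [simp]: "a \<in> carrier R" "b \<in> carrier R" "x \<in> carrier R" "y \<in> carrier R" "u \<in> carrier R"
    and inverse: "a \<otimes> x = u" "b \<otimes> y = u" "a \<otimes> y = \<zero>" "b \<otimes> x = \<zero>"
    and unit: "a \<otimes> u = a" "b \<otimes> u = b" and nonzero: "u \<noteq> \<zero>"
begin

abbreviation "word_prod w \<equiv> foldr (\<otimes>) w \<one>"

definition "dual g = (if g = a then x else y)"

lemma a_neq_b: "a \<noteq> b"
  using inverse nonzero by auto

lemma dual: "g \<in> {a, b} \<Longrightarrow> g' \<in> {a, b} \<Longrightarrow> g \<otimes> dual g' = (if g = g' then u else \<zero>)"
  using a_neq_b inverse by (auto simp: dual_def)

lemma word_prod_closed: "set w \<subseteq> {a, b} \<Longrightarrow> word_prod w \<in> carrier R"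
  by (induction w) auto

lemma dual_prod_closed: "dual_prod dual w \<in> carrier R"
  by (induction w) (auto simp: dual_def)

text \<open>The inner product is \<open>u\<close> or zero by induction, and the letter to the left
  of \<open>u\<close> absorbs it. Empty words are excluded because their product is \<one>, not
  \<open>u\<close>; for the same reason one-letter words are treated separately in the step.\<close>

lemma word_prod_dual:
  assumes "length w = length w'" "w \<noteq> []" "set w \<subseteq> {a, b}" "set w' \<subseteq> {a, b}"
  shows "word_prod w \<otimes> dual_prod dual w' = (if w = w' then u else \<zero>)"
  using assms
proof (induction w w' rule: list_induct2)
  case (Cons g w g' w')
  have c: "g \<in> carrier R" "dual g' \<in> carrier R" "word_prod w \<in> carrier R"
    using Cons.prems word_prod_closed[of w] by (auto simp: dual_def)
  have "word_prod (g # w) \<otimes> dual_prod dual (g' # w')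
      = g \<otimes> (word_prod w \<otimes> dual_prod dual w') \<otimes> dual g'"
    using c dual_prod_closed[of w'] by (simp add: m_assoc)
  also have "\<dots> = (if w = w' then g \<otimes> dual g' else \<zero>)"
  proof (cases "w = []")
    case True
    then show ?thesis using Cons.hyps c by simp
  next
    case False
    moreover have "g \<otimes> u = g" using Cons.prems unit by auto
    ultimately show ?thesis using Cons c by simp
  qed
  also have "\<dots> = (if g # w = g' # w' then u else \<zero>)"
  proof -
    have "g \<otimes> dual g' = (if g = g' then u else \<zero>)"
      by (rule dual) (use Cons.prems in auto)
    then show ?thesis by (auto split: if_splits)
  qed
  finally show ?case .
qed simp

lemma independent_words:
  assumes K: "K \<subseteq> carrier R" and "distinct ws" "n > 0"
    and "\<And>w. w \<in> set ws \<Longrightarrow> set w \<subseteq> {a, b} \<and> length w = n"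
  shows "independent K (map word_prod ws)"
  using assms(2,4)
proof (induction ws)
  case (Cons w ws)
  have w: "set w \<subseteq> {a, b}" "length w = n" "w \<noteq> []"
    using Cons.prems(2)[of w] \<open>n > 0\<close> by auto
  have "word_prod w \<notin> Span K (map word_prod ws)"
  proof
    assume span: "word_prod w \<in> Span K (map word_prod ws)"
    have "word_prod w \<otimes> dual_prod dual w = \<zero>"
    proof (rule Span_annihilated[OF K _ dual_prod_closed _ span])
      show "set (map word_prod ws) \<subseteq> carrier R"
        using Cons.prems(2) word_prod_closed by auto
      fix z assume "z \<in> set (map word_prod ws)"
      then obtain w' where w': "w' \<in> set ws" "z = word_prod w'" by auto
      then have "w' \<noteq> w" "set w' \<subseteq> {a, b}" "length w' = n" "w' \<noteq> []"
        using Cons.prems(1) Cons.prems(2)[of w'] \<open>n > 0\<close> by auto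
      then show "z \<otimes> dual_prod dual w = \<zero>"
        using w w' by (simp add: word_prod_dual)
    qed
    then show False
      using w nonzero by (simp add: word_prod_dual)
  qed
  then show ?case
    using Cons word_prod_closed[OF w(1)] by (auto intro!: li_Cons)
qed simp

lemma exponential_independent:
  assumes "K \<subseteq> carrier R" "n > 0"
  shows "independent K (map word_prod (List.n_lists n [a, b]))"
  using assms a_neq_b
  by (intro independent_words[where n = n]) (auto simp: set_n_lists intro!: distinct_n_lists)

lemma length_binary_words: "length (map word_prod (List.n_lists n [a, b])) = 2 ^ n"
  by (simp add: length_n_lists numeral_2_eq_2)

lemma infinite_dimension:
  assumes K: "subfield K R"
  shows "infinite_dimension K (carrier R)"
proof
  assume "finite_dimension K (carrier R)"
  then obtain n where n: "dimension n K (carrier R)" by blast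
  have "length (map word_prod (List.n_lists (Suc n) [a, b])) \<le> n"
    using word_prod_closed subfieldE(3)[OF K]
    by (intro independent_length_le_dimension[OF K n] exponential_independent)
      (auto simp: set_n_lists)
  then show False
    using less_exp[of "Suc n"] unfolding length_binary_words by simp
qed

lemma exponential_growth:
  assumes K: "subfield K R" and n: "n > 0"
  shows "2 ^ n \<le> growth K R [a, b] n"
proof -
  let ?L = "map word_prod (concat (map (\<lambda>i. List.n_lists i [a, b]) [0..<Suc n]))"
  have L: "set ?L \<subseteq> carrier R"
    using word_prod_closed by (auto simp: set_n_lists)
  have "dimension (dim K (Span K ?L)) K (Span K ?L)"
    using finite_dimensionE[OF K Span_finite_dimension[OF K L]] by (simp add: over_def)
  moreover have "set (map word_prod (List.n_lists n [a, b])) \<subseteq> Span K ?L"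
    using Span_base_incl[OF K L] by auto
  ultimately have "length (map word_prod (List.n_lists n [a, b])) \<le> dim K (Span K ?L)"
    using exponential_independent[OF subfieldE(3)[OF K] n] by (intro independent_length_le_dimension[OF K])
  then show ?thesis
    unfolding length_binary_words growth_def .
qed

text \<open>The logarithm of 2^n to base n is n ln 2 / ln n, which is unbounded, so the single list
  \<open>[a, b]\<close> already makes the supremum infinite.\<close>

lemma GK_dim_infinite:
  assumes K: "subfield K R"
  shows "GK_dim K R = \<infinity>"
proof -
  have "((\<lambda>n. ereal (log (real n) (real (growth K R [a, b] n)))) \<longlongrightarrow> \<infinity>) sequentially"
    unfolding tendsto_PInfty
  proof
    fix r
    have "filterlim (\<lambda>n. real n * ln 2 / ln (real n)) at_top sequentially"
      by real_asymp
    then have "\<forall>\<^sub>F n in sequentially. r < real n * ln 2 / ln (real n)"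
      by (simp add: filterlim_at_top_dense)
    then show "\<forall>\<^sub>F n in sequentially. ereal r < ereal (log (real n) (real (growth K R [a, b] n)))"
      \<comment> \<open>The base n has to exceed 1 for the logarithm to be monotone.\<close>
      using eventually_gt_at_top[of 1]
    proof eventually_elim
      case (elim n)
      have "real (2 ^ n) \<le> real (growth K R [a, b] n)"
        using exponential_growth[OF K, of n] elim by (intro of_nat_mono) auto
      then have "log (real n) (2 ^ n) \<le> log (real n) (real (growth K R [a, b] n))"
        using elim by (intro log_mono) auto
      moreover have "log (real n) (2 ^ n) = real n * ln 2 / ln (real n)"
        by (simp add: log_def ln_realpow)
      ultimately show ?case using elim by simp
    qed
  qed
  then have "limsup (\<lambda>n. ereal (log (real n) (real (growth K R [a, b] n)))) = \<infinity>"
    by (intro lim_imp_Limsup) auto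
  then have "\<infinity> \<le> GK_dim K R"
    unfolding GK_dim_def by (intro SUP_upper2[of "[a, b]"]) auto
  then show ?thesis by (simp add: top_unique)
qed

end

section \<open>Real and ghost paths\<close>

context leavitt_hom begin

text \<open>\<open>p\<close> is the product of the arcs along a path from \<open>u\<close> to
  \<open>v\<close> and \<open>q\<close> the product of their ghosts in reverse order; (CK1)
  collapses \<open>q \<otimes> p\<close> from the inside.\<close>

lemma path_element:
  assumes "(u, v) \<in> (arcs_ends G)\<^sup>*" "v \<in> verts G"
  shows "\<exists>p \<in> carrier B. \<exists>q \<in> carrier B. q \<otimes> p = \<nu> v \<and> \<nu> u \<otimes> p = p \<and> q \<otimes> \<nu> u = q"
  using assms(1)
proof (induction rule: converse_rtrancl_induct)
  case base
  then show ?case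
    using assms(2) by (intro bexI[of _ "\<nu> v"]) (auto simp: vert_vert)
next
  case (step u w)
  then obtain p q where pq: "p \<in> carrier B" "q \<in> carrier B" "q \<otimes> p = \<nu> v" "\<nu> w \<otimes> p = p" "q \<otimes> \<nu> w = q"
    by auto
  obtain e where e: "e \<in> arcs G" "u = tail G e" "w = head G e"
    using step.hyps by (auto simp: arcs_ends_conv)
  have "q \<otimes> \<gamma> e \<otimes> (\<alpha> e \<otimes> p) = q \<otimes> ((\<gamma> e \<otimes> \<alpha> e) \<otimes> p)"
    using pq e by (simp add: B.m_assoc)
  also have "\<dots> = \<nu> v"
    using pq e by (simp add: ghost_arc)
  finally have "q \<otimes> \<gamma> e \<otimes> (\<alpha> e \<otimes> p) = \<nu> v" .
  moreover have "\<nu> u \<otimes> (\<alpha> e \<otimes> p) = \<alpha> e \<otimes> p" "q \<otimes> \<gamma> e \<otimes> \<nu> u = q \<otimes> \<gamma> e"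
    using pq e arc_simps[OF e(1)] by (simp_all add: B.m_assoc[symmetric]) (simp_all add: B.m_assoc)
  ultimately show ?case
    using pq e by (intro bexI[of _ "\<alpha> e \<otimes> p"] bexI[of _ "q \<otimes> \<gamma> e"]) auto
qed

text \<open>Each arc is closed up by a return path, and the closed paths stay orthogonal because
  they start with different arcs. That the vertex is nonzero is a hypothesis since the lemma is also
  applied in quotients, where it may fail: the second conclusion then forces the vertex to vanish in
  every finite-dimensional quotient.\<close>

lemma two_returning_arcs:
  assumes ef: "e \<in> arcs G" "f \<in> arcs G" "e \<noteq> f" "tail G e = v" "tail G f = v"
    and ret: "(head G e, v) \<in> (arcs_ends G)\<^sup>*" "(head G f, v) \<in> (arcs_ends G)\<^sup>*"
    and nz: "\<nu> v \<noteq> \<zero>"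
  shows "GK_dim (range \<kappa>) B = \<infinity>" "B.infinite_dimension (range \<kappa>) (carrier B)"
proof -
  have v: "v \<in> verts G" using ef by auto
  obtain p q where pq: "p \<in> carrier B" "q \<in> carrier B" "q \<otimes> p = \<nu> v"
      "\<nu> (head G e) \<otimes> p = p" "q \<otimes> \<nu> (head G e) = q"
    using path_element[OF ret(1) v] by auto
  obtain p' q' where pq': "p' \<in> carrier B" "q' \<in> carrier B" "q' \<otimes> p' = \<nu> v"
      "\<nu> (head G f) \<otimes> p' = p'" "q' \<otimes> \<nu> (head G f) = q'"
    using path_element[OF ret(2) v] by auto
  have mult: "r \<otimes> \<gamma> c \<otimes> (\<alpha> d \<otimes> s) = r \<otimes> ((\<gamma> c \<otimes> \<alpha> d) \<otimes> s)"
    if "r \<in> carrier B" "s \<in> carrier B" "c \<in> arcs G" "d \<in> arcs G" for r s c d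
    using that by (simp add: B.m_assoc)
  interpret leavitt_pair B "q \<otimes> \<gamma> e" "q' \<otimes> \<gamma> f" "\<alpha> e \<otimes> p" "\<alpha> f \<otimes> p'" "\<nu> v"
  proof
    show "q \<otimes> \<gamma> e \<otimes> (\<alpha> e \<otimes> p) = \<nu> v" "q' \<otimes> \<gamma> f \<otimes> (\<alpha> f \<otimes> p') = \<nu> v"
      "q \<otimes> \<gamma> e \<otimes> (\<alpha> f \<otimes> p') = \<zero>" "q' \<otimes> \<gamma> f \<otimes> (\<alpha> e \<otimes> p) = \<zero>"
      using ef pq pq' by (simp_all add: mult ghost_arc)
    show "q \<otimes> \<gamma> e \<otimes> \<nu> v = q \<otimes> \<gamma> e" "q' \<otimes> \<gamma> f \<otimes> \<nu> v = q' \<otimes> \<gamma> f"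
      using ef pq pq' v arc_simps(4)[of e] arc_simps(4)[of f] by (simp_all add: B.m_assoc)
  qed (use ef pq pq' v nz in auto)
  have "\<one> \<noteq> \<zero>"
  proof
    assume "\<one> = \<zero>"
    then have "\<one> \<otimes> \<nu> v = \<zero> \<otimes> \<nu> v" by simp
    then show False using nz v by simp
  qed
  then have K: "subfield (range \<kappa>) B" by (rule kappa_subfield)
  show "GK_dim (range \<kappa>) B = \<infinity>" "B.infinite_dimension (range \<kappa>) (carrier B)"
    using GK_dim_infinite[OF K] infinite_dimension[OF K] by auto
qed

end

section \<open>Representations from branching systems\<close>

lemma (in ring) minus_in_ideal_iff:
  assumes "ideal I R" "a \<in> carrier R" "b \<in> carrier R"
  shows "a \<ominus> b \<in> I \<longleftrightarrow> I +> a = I +> b"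
  using quotient_eq_iff_same_a_r_cos[OF assms] .

section \<open>Descent of a representation to a quotient ring\<close>

context fin_rep begin

definition "rep_kernel = {a \<in> carrier R. \<forall>f \<in> Fin X. \<rho> a f = 0}"

lemma rep_uminus: "a \<in> carrier R \<Longrightarrow> f \<in> Fin X \<Longrightarrow> \<rho> (\<ominus> a) f = - \<rho> a f"
  using rep_add[of "\<ominus> a" a f] rep_zero[of f] by (simp add: l_neg eq_neg_iff_add_eq_0)

lemma rep_operator_zero: "a \<in> carrier R \<Longrightarrow> \<rho> a 0 = 0"
  using rep_sum[of a "\<lambda>_. 0" "{}"] by simp

lemma rep_kernel_ideal: "ideal rep_kernel R"
proof (rule idealI)
  show "subgroup rep_kernel (add_monoid R)"
    by (rule add.subgroupI)
      (auto simp: rep_kernel_def rep_zero rep_uminus rep_add a_inv_def[symmetric] intro: exI[of _ \<zero>])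
qed (auto simp: rep_kernel_def rep_mult rep_closed rep_operator_zero intro: ring_axioms)

lemma rep_eq_of_same_coset:
  assumes "ideal J R" "J \<subseteq> rep_kernel" "a \<in> carrier R" "b \<in> carrier R" "J +> a = J +> b" "f \<in> Fin X"
  shows "\<rho> a f = \<rho> b f"
proof -
  have "a \<ominus> b \<in> rep_kernel"
    using assms minus_in_ideal_iff by blast
  then show ?thesis
    using assms(3,4,6) by (simp add: rep_kernel_def minus_eq rep_add rep_uminus)
qed

text \<open>A coset acts through a chosen representative. On \<open>Fin X\<close> the choice is
  immaterial because \<open>J\<close> annihilates that space, and everywhere else the operator is
  still linear, being that of a ring element.\<close>

lemma quotient_rep:
  assumes J: "ideal J R" and sub: "J \<subseteq> rep_kernel"
  defines "\<rho>' \<equiv> \<lambda>c. \<rho> (SOME a. a \<in> carrier R \<and> J +> a = c)"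
  shows "fin_rep (R Quot J) X \<rho>'"
    and "\<And>a f. a \<in> carrier R \<Longrightarrow> f \<in> Fin X \<Longrightarrow> \<rho>' (J +> a) f = \<rho> a f"
proof -
  interpret J: ideal J R by fact
  interpret Q: ring "R Quot J" by (rule J.quotient_is_ring)
  note hom = J.rcos_ring_hom
  have some: "\<exists>a. a \<in> carrier R \<and> J +> a = c" if "c \<in> carrier (R Quot J)" for c
    using that by (auto simp: FactRing_def A_RCOSETS_def')
  define s where "s c = (SOME a. a \<in> carrier R \<and> J +> a = c)" for c
  have s: "s c \<in> carrier R" "J +> s c = c" if "c \<in> carrier (R Quot J)" for c
    using someI_ex[OF some[OF that]] by (auto simp: s_def)
  have \<rho>': "\<rho>' c = \<rho> (s c)" for c by (simp add: \<rho>'_def s_def)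
  show eq: "\<rho>' (J +> a) f = \<rho> a f" if "a \<in> carrier R" "f \<in> Fin X" for a f
    using s[OF ring_hom_closed[OF hom that(1)]] that unfolding \<rho>'
    by (intro rep_eq_of_same_coset[OF J sub]) auto
  have add: "(J +> a) \<oplus>\<^bsub>R Quot J\<^esub> (J +> b) = J +> (a \<oplus> b)"
    and mult: "(J +> a) \<otimes>\<^bsub>R Quot J\<^esub> (J +> b) = J +> (a \<otimes> b)"
    if "a \<in> carrier R" "b \<in> carrier R" for a b
    using that by (simp_all add: ring_hom_add[OF hom] ring_hom_mult[OF hom])
  show "fin_rep (R Quot J) X \<rho>'"
  proof (rule fin_rep.intro[OF Q.ring_axioms], rule fin_rep_axioms.intro)
    fix c d :: "'a set" and f :: "'x \<Rightarrow> 'k"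
    assume c: "c \<in> carrier (R Quot J)"
    show "Vector_Spaces.linear fscale fscale (\<rho>' c)"
      unfolding \<rho>' by (rule rep_linear s c)+
    assume f: "f \<in> Fin X"
    show "\<rho>' c f \<in> Fin X"
      unfolding \<rho>' using f s[OF c] by (simp add: rep_closed)
    assume d: "d \<in> carrier (R Quot J)"
    show "\<rho>' (c \<oplus>\<^bsub>R Quot J\<^esub> d) f = \<rho>' c f + \<rho>' d f"
      using eq[of "s c \<oplus> s d" f] add[of "s c" "s d"] s[OF c] s[OF d] f
      by (simp add: \<rho>' rep_add)
    show "\<rho>' (c \<otimes>\<^bsub>R Quot J\<^esub> d) f = \<rho>' c (\<rho>' d f)"
      using eq[of "s c \<otimes> s d" f] mult[of "s c" "s d"] s[OF c] s[OF d] f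
      by (simp add: \<rho>' rep_mult)
  next
    fix f :: "'x \<Rightarrow> 'k" assume "f \<in> Fin X"
    then show "\<rho>' \<one>\<^bsub>R Quot J\<^esub> f = f"
      using eq[of \<one> f] ring_hom_one[OF hom] by (simp add: rep_one)
  qed
qed

end

definition cls :: "('v, 'e) pre_digraph \<Rightarrow> (('v, 'e) leavitt_gen, 'k::field) ncpoly \<Rightarrow>
    (('v, 'e) leavitt_gen, 'k) ncpoly set" where
  "cls G p = leavitt_ideal TYPE('k) G +>\<^bsub>free_algebra TYPE('k) (leavitt_gens G)\<^esub> p"

lemma leavitt_hom_cls:
  assumes "fin_digraph G"
  shows "leavitt_hom G (leavitt_path_algebra TYPE('k::field) G) (cls G)"
proof -
  interpret fin_digraph G by fact
  interpret F: ring "free_algebra TYPE('k) (leavitt_gens G)" by (rule free_algebra_ring)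
  interpret I: ideal "leavitt_ideal TYPE('k) G" "free_algebra TYPE('k) (leavitt_gens G)"
    by (rule leavitt_ideal_ideal) fact
  interpret A: ring "leavitt_path_algebra TYPE('k) G"
    by (rule leavitt_path_algebra_ring) fact
  show ?thesis
  proof
    show "cls G \<in> ring_hom (free_algebra TYPE('k) (leavitt_gens G)) (leavitt_path_algebra TYPE('k) G)"
      unfolding leavitt_path_algebra_def cls_def by (rule I.rcos_ring_hom)
    fix r :: "(('a, 'b) leavitt_gen, 'k) ncpoly" assume r: "r \<in> leavitt_rels TYPE('k) G"
    then have "r \<in> leavitt_ideal TYPE('k) G"
      unfolding leavitt_ideal_def
      using F.genideal_self[OF leavitt_rels_carrier[OF assms]] by auto
    then show "cls G r = \<zero>\<^bsub>leavitt_path_algebra TYPE('k) G\<^esub>"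
      by (simp add: cls_def leavitt_path_algebra_def FactRing_def I.a_rcos_const)
  qed
qed

lemma leavitt_scalars_eq: "leavitt_scalars TYPE('k::field) G = range (\<lambda>c :: 'k. cls G (ncconst c))"
  by (simp add: leavitt_scalars_def cls_def)

lemma carrier_leavitt:
  "carrier (leavitt_path_algebra TYPE('k::field) G) = cls G ` carrier (free_algebra TYPE('k) (leavitt_gens G))"
  by (auto simp: leavitt_path_algebra_def cls_def FactRing_def A_RCOSETS_def')

lemma leavitt_hom_quotient:
  assumes "fin_digraph G" and I: "ideal I (leavitt_path_algebra TYPE('k::field) G)"
  shows "leavitt_hom G (leavitt_path_algebra TYPE('k) G Quot I)
    (\<lambda>p. I +>\<^bsub>leavitt_path_algebra TYPE('k) G\<^esub> cls G p)"
proof -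
  interpret A: leavitt_hom G "leavitt_path_algebra TYPE('k) G" "cls G"
    by (rule leavitt_hom_cls) fact
  interpret I: ideal I "leavitt_path_algebra TYPE('k) G" by fact
  interpret Q: ring "leavitt_path_algebra TYPE('k) G Quot I" by (rule I.quotient_is_ring)
  show ?thesis
  proof
    show "(\<lambda>p. I +>\<^bsub>leavitt_path_algebra TYPE('k) G\<^esub> cls G p)
        \<in> ring_hom (free_algebra TYPE('k) (leavitt_gens G)) (leavitt_path_algebra TYPE('k) G Quot I)"
      using ring_hom_trans[OF A.hom I.rcos_ring_hom] by (simp add: comp_def)
  next
    fix r :: "(('a, 'b) leavitt_gen, 'k) ncpoly" assume "r \<in> leavitt_rels TYPE('k) G"
    then show "I +>\<^bsub>leavitt_path_algebra TYPE('k) G\<^esub> cls G r = \<zero>\<^bsub>leavitt_path_algebra TYPE('k) G Quot I\<^esub>"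
      by (simp add: A.rels FactRing_def I.a_rcos_const I.zero_closed)
  qed
qed

text \<open>The maps \<open>\<phi> e\<close> are total and constrained only on
  \<open>X (head G e)\<close>, so that two systems with different point sets can share the same
  \<open>\<phi>\<close>.\<close>

locale branching = fin_digraph G for G :: "('v, 'e) pre_digraph" +
  fixes X :: "'v \<Rightarrow> 'x set" and \<phi> :: "'e \<Rightarrow> 'x \<Rightarrow> 'x"
  assumes disjoint: "v \<in> verts G \<Longrightarrow> w \<in> verts G \<Longrightarrow> x \<in> X v \<Longrightarrow> x \<in> X w \<Longrightarrow> v = w"
    and bij: "v \<in> verts G \<Longrightarrow> out_arcs G v \<noteq> {} \<Longrightarrow>
      bij_betw (\<lambda>(e, x). \<phi> e x) (SIGMA e:out_arcs G v. X (head G e)) (X v)"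

text \<open>Functions are pulled back, so points move against \<open>\<phi>\<close> along an arc and
  with it along a ghost. In this way \<open>e\<close> carries functions on X(t(e)) to functions on
  X(s(e)), as s(e) e = e = e t(e) requires.\<close>

fun branch_step :: "('v, 'e) pre_digraph \<Rightarrow> ('v \<Rightarrow> 'x set) \<Rightarrow> ('e \<Rightarrow> 'x \<Rightarrow> 'x) \<Rightarrow>
    ('v, 'e) leavitt_gen \<Rightarrow> 'x \<Rightarrow> 'x option" where
  "branch_step G X \<phi> (Vert v) z = (if z \<in> X v then Some z else None)"
| "branch_step G X \<phi> (Arc e) z = (if z \<in> \<phi> e ` X (head G e) then Some (inv_into (X (head G e)) (\<phi> e) z) else None)"
| "branch_step G X \<phi> (Ghost e) z = (if z \<in> X (head G e) then Some (\<phi> e z) else None)"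

context branching begin

abbreviation "points \<equiv> \<Union>v\<in>verts G. X v"
abbreviation "\<tau> \<equiv> branch_step G X \<phi>"

lemma phi_in: "e \<in> arcs G \<Longrightarrow> x \<in> X (head G e) \<Longrightarrow> \<phi> e x \<in> X (tail G e)"
  using bij[of "tail G e"] by (fastforce simp: bij_betw_def)

lemma phi_inject:
  assumes "e \<in> arcs G" "f \<in> arcs G" "x \<in> X (head G e)" "y \<in> X (head G f)" "\<phi> e x = \<phi> f y"
  shows "e = f \<and> x = y"
proof -
  have tail: "tail G e = tail G f"
    using disjoint[of "tail G e" "tail G f" "\<phi> e x"] phi_in[of e x] phi_in[of f y] assms by auto
  have "inj_on (\<lambda>(e, x). \<phi> e x) (SIGMA e:out_arcs G (tail G e). X (head G e))"
  proof -
    have "e \<in> out_arcs G (tail G e)" using assms by simp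
    then have "out_arcs G (tail G e) \<noteq> {}" by blast
    from bij[OF tail_in_verts[OF assms(1)] this] show ?thesis by (rule bij_betw_imp_inj_on)
  qed
  from inj_onD[OF this, of "(e, x)" "(f, y)"] show ?thesis
    using assms tail by auto
qed

lemma step_Arc_iff: "e \<in> arcs G \<Longrightarrow> \<tau> (Arc e) z = Some y \<longleftrightarrow> y \<in> X (head G e) \<and> \<phi> e y = z"
proof -
  assume e: "e \<in> arcs G"
  have inj: "inj_on (\<phi> e) (X (head G e))"
    using e by (auto intro!: inj_onI dest: phi_inject)
  show ?thesis
  proof
    assume "\<tau> (Arc e) z = Some y"
    then have "z \<in> \<phi> e ` X (head G e)" "y = inv_into (X (head G e)) (\<phi> e) z"
      by (simp_all split: if_splits)
    then show "y \<in> X (head G e) \<and> \<phi> e y = z"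
      by (simp add: f_inv_into_f inv_into_into)
  next
    assume y: "y \<in> X (head G e) \<and> \<phi> e y = z"
    then have "z \<in> \<phi> e ` X (head G e)" by blast
    moreover have "inv_into (X (head G e)) (\<phi> e) z = y"
      using y inv_into_f_f[OF inj, of y] by simp
    ultimately show "\<tau> (Arc e) z = Some y" by simp
  qed
qed

lemma step_Some:
  assumes "g \<in> leavitt_gens G" "\<tau> g z = Some y"
  shows "z \<in> X (gen_src G g)" "y \<in> X (gen_tgt G g)" "gen_src G g \<in> verts G" "gen_tgt G g \<in> verts G"
proof -
  have "z \<in> X (gen_src G g) \<and> y \<in> X (gen_tgt G g) \<and> gen_src G g \<in> verts G \<and> gen_tgt G g \<in> verts G"
  proof (cases g)
    case (Vert v)
    then show ?thesis using assms by (auto simp: leavitt_gens_def split: if_splits)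
  next
    case (Arc e)
    then have "e \<in> arcs G" using assms by (auto simp: leavitt_gens_def)
    then show ?thesis
      using Arc assms step_Arc_iff[of e z y] phi_in[of e y] by (auto simp del: branch_step.simps)
  next
    case (Ghost e)
    then show ?thesis using assms phi_in[of e z] by (auto simp: leavitt_gens_def split: if_splits)
  qed
  then show "z \<in> X (gen_src G g)" "y \<in> X (gen_tgt G g)" "gen_src G g \<in> verts G" "gen_tgt G g \<in> verts G"
    by auto
qed

lemma step_inject:
  assumes "g \<in> leavitt_gens G" "\<tau> g z = Some y" "\<tau> g z' = Some y"
  shows "z = z'"
proof (cases g)
  case (Arc e)
  then have "e \<in> arcs G" using assms by (auto simp: leavitt_gens_def)
  then show ?thesis using Arc assms step_Arc_iff[of e] by (auto simp del: branch_step.simps)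
next
  case (Ghost e)
  then show ?thesis
    using assms phi_inject[of e e z z'] by (auto simp: leavitt_gens_def split: if_splits)
qed (use assms in \<open>auto split: if_splits\<close>)

text \<open>Every generator is a partial injection, so the fibres of a word have at most one point
  and pullbacks keep finite support.\<close>

lemma run_inject:
  "set w \<subseteq> leavitt_gens G \<Longrightarrow> run \<tau> w z = Some y \<Longrightarrow> run \<tau> w z' = Some y \<Longrightarrow> z = z'"
proof (induction w arbitrary: z z')
  case (Cons g w)
  then obtain x x' where "\<tau> g z = Some x" "\<tau> g z' = Some x'" "run \<tau> w x = Some y" "run \<tau> w x' = Some y"
    by (auto simp: bind_eq_Some_conv)
  with Cons show ?case using step_inject[of g z x z'] by auto
qed simp

lemma run_points:
  "set w \<subseteq> leavitt_gens G \<Longrightarrow> run \<tau> w z = Some y \<Longrightarrow> z \<in> points \<longleftrightarrow> y \<in> points"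
proof (induction w arbitrary: z)
  case (Cons g w)
  then obtain x where "\<tau> g z = Some x" "run \<tau> w x = Some y"
    by (auto simp: bind_eq_Some_conv)
  with Cons show ?case using step_Some[of g z x] by auto
qed simp

lemma free_rep: "fin_rep (free_algebra TYPE('k::field) (leavitt_gens G)) points (act \<tau>)"
proof -
  interpret F: ring "free_algebra TYPE('k) (leavitt_gens G)" by (rule free_algebra_ring)
  show ?thesis
  proof (rule fin_rep.intro[OF F.ring_axioms], rule fin_rep_axioms.intro)
    fix p :: "(('v, 'e) leavitt_gen, 'k) ncpoly" and f :: "'x \<Rightarrow> 'k"
    assume p: "p \<in> carrier (free_algebra TYPE('k) (leavitt_gens G))" and f: "f \<in> Fin points"
    show "act \<tau> p f \<in> Fin points"
    proof (rule act_Fin[where A = "leavitt_gens G", OF _ _ _ f])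
      fix w and y assume w: "set w \<subseteq> leavitt_gens G"
      show "finite {x. run \<tau> w x = Some y}"
      proof (cases "\<exists>z. run \<tau> w z = Some y")
        case True
        then obtain z where "run \<tau> w z = Some y" by blast
        then have "{x. run \<tau> w x = Some y} \<subseteq> {z}"
          using w run_inject[of w] by blast
        then show ?thesis by (rule finite_subset) simp
      qed simp
    next
      fix w z y assume w: "set w \<subseteq> leavitt_gens G" and y: "y \<in> points" and wzy: "run \<tau> w z = Some y"
      show "z \<in> points" using run_points[OF w wzy] y by (rule iffD2)
    qed (use p in \<open>auto simp: free_algebra_def\<close>)
  qed (simp_all add: act_Vector_Spaces_linear act_mult act_add act_one free_algebra_def)
qed


section \<open>The Leavitt relations hold for the action\<close>

lemma act_Vert: "act \<tau> (ncvar (Vert v)) f z = (if z \<in> X v then f z else 0)"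
  by (simp add: act_ncvar pull_def)

lemma act_Ghost: "act \<tau> (ncvar (Ghost e)) f z = (if z \<in> X (head G e) then f (\<phi> e z) else 0)"
  by (simp add: act_ncvar pull_def)

lemma act_Arc:
  assumes "e \<in> arcs G"
  shows "y \<in> X (head G e) \<Longrightarrow> act \<tau> (ncvar (Arc e)) f (\<phi> e y) = f y"
    "z \<notin> \<phi> e ` X (head G e) \<Longrightarrow> act \<tau> (ncvar (Arc e)) f z = 0"
proof -
  assume "y \<in> X (head G e)"
  then have "\<tau> (Arc e) (\<phi> e y) = Some y"
    using step_Arc_iff[OF assms] by (simp del: branch_step.simps)
  then show "act \<tau> (ncvar (Arc e)) f (\<phi> e y) = f y"
    by (simp add: act_ncvar pull_def del: branch_step.simps)
qed (simp add: act_ncvar pull_def)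

lemma act_Arc_Ghost:
  assumes "e \<in> arcs G"
  shows "act \<tau> (ncvar (Arc e)) (act \<tau> (ncvar (Ghost e)) f) z = (if z \<in> \<phi> e ` X (head G e) then f z else 0)"
  by (auto simp: act_Ghost act_Arc[OF assms])

lemma act_src:
  assumes "x \<in> leavitt_gens G"
  shows "act \<tau> (ncvar (Vert (gen_src G x))) (act \<tau> (ncvar x) f) = act \<tau> (ncvar x) f"
proof
  fix z
  have "act \<tau> (ncvar x) f z = 0" if "z \<notin> X (gen_src G x)"
  proof -
    have "\<tau> x z = None"
      using step_Some(1)[OF assms, of z] that by (cases "\<tau> x z") auto
    then show ?thesis by (simp add: act_ncvar pull_def)
  qed
  then show "act \<tau> (ncvar (Vert (gen_src G x))) (act \<tau> (ncvar x) f) z = act \<tau> (ncvar x) f z"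
    by (simp add: act_Vert)
qed

lemma act_tgt:
  assumes "x \<in> leavitt_gens G"
  shows "act \<tau> (ncvar x) (act \<tau> (ncvar (Vert (gen_tgt G x))) f) = act \<tau> (ncvar x) f"
proof
  fix z
  show "act \<tau> (ncvar x) (act \<tau> (ncvar (Vert (gen_tgt G x))) f) z = act \<tau> (ncvar x) f z"
  proof (cases "\<tau> x z")
    case None
    then show ?thesis by (simp add: act_ncvar pull_def)
  next
    case (Some y)
    then have "y \<in> X (gen_tgt G x)" by (rule step_Some(2)[OF assms])
    then show ?thesis using Some by (simp add: act_Vert act_ncvar[of \<tau> x] pull_def)
  qed
qed

lemma act_Ghost_Arc:
  assumes "e \<in> arcs G" "f \<in> arcs G"
  shows "act \<tau> (ncvar (Ghost e)) (act \<tau> (ncvar (Arc f)) g) z =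
    (if e = f \<and> z \<in> X (head G e) then g z else 0)"
proof (cases "z \<in> X (head G e)")
  case z: True
  have "\<phi> e z \<notin> \<phi> f ` X (head G f)" if "e \<noteq> f"
    using phi_inject[OF assms z] that by auto
  then show ?thesis
    using z by (auto simp: act_Ghost act_Arc[OF assms(2)])
qed (simp add: act_Ghost)

lemma sum_act_verts:
  assumes "f \<in> Fin points"
  shows "(\<Sum>v\<in>verts G. act \<tau> (ncvar (Vert v)) f) = f"
proof
  fix z
  have "(\<Sum>v\<in>verts G. act \<tau> (ncvar (Vert v)) f z) = f z"
  proof (cases "z \<in> points")
    case True
    then obtain w where w: "w \<in> verts G" "z \<in> X w" by auto
    then have "(\<Sum>v\<in>verts G. act \<tau> (ncvar (Vert v)) f z) = (\<Sum>v\<in>verts G. if v = w then f z else 0)"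
      using disjoint by (intro sum.cong) (auto simp: act_Vert)
    then show ?thesis using w by simp
  next
    case False
    then have "f z = 0" using assms by (auto simp: Fin_def)
    then show ?thesis by (intro trans[OF sum.neutral]) (auto simp: act_Vert)
  qed
  then show "(\<Sum>v\<in>verts G. act \<tau> (ncvar (Vert v)) f) z = f z"
    by (simp add: sum_fun_apply)
qed

text \<open>The images of the \<open>\<phi> e\<close> for the arcs leaving \<open>v\<close>
  partition \<open>X v\<close>, so at each point of \<open>X v\<close> exactly one summand
  survives.\<close>

lemma sum_act_arcs:
  assumes v: "v \<in> verts G" "out_arcs G v \<noteq> {}"
  shows "(\<Sum>e\<in>out_arcs G v. act \<tau> (ncvar (Arc e)) (act \<tau> (ncvar (Ghost e)) f)) = act \<tau> (ncvar (Vert v)) f"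
proof
  fix z
  have X: "X v = (\<Union>e\<in>out_arcs G v. \<phi> e ` X (head G e))"
    using bij_betw_imp_surj_on[OF bij[OF v], symmetric] by force
  have "(\<Sum>e\<in>out_arcs G v. act \<tau> (ncvar (Arc e)) (act \<tau> (ncvar (Ghost e)) f) z)
      = (\<Sum>e\<in>out_arcs G v. if z \<in> \<phi> e ` X (head G e) then f z else 0)"
    by (intro sum.cong) (auto simp: act_Arc_Ghost)
  also have "\<dots> = (if z \<in> X v then f z else 0)"
  proof (cases "z \<in> X v")
    case True
    then obtain e y where e: "e \<in> out_arcs G v" "y \<in> X (head G e)" "z = \<phi> e y"
      unfolding X by auto
    have "z \<in> \<phi> d ` X (head G d) \<longleftrightarrow> d = e" if d: "d \<in> out_arcs G v" for d
      using phi_inject[of e d y] d e by auto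
    then have "(\<Sum>e\<in>out_arcs G v. if z \<in> \<phi> e ` X (head G e) then f z else 0)
        = (\<Sum>d\<in>out_arcs G v. if d = e then f z else 0)"
      by (intro sum.cong refl) simp
    moreover have "finite (out_arcs G v)"
      by (rule finite_subset[OF _ finite_arcs]) auto
    ultimately show ?thesis using e True by (simp add: sum.delta)
  next
    case False
    then have "z \<notin> \<phi> e ` X (head G e)" if "e \<in> out_arcs G v" for e
      using that unfolding X by blast
    then show ?thesis using False by (intro trans[OF sum.neutral]) auto
  qed
  finally show "(\<Sum>e\<in>out_arcs G v. act \<tau> (ncvar (Arc e)) (act \<tau> (ncvar (Ghost e)) f)) z
      = act \<tau> (ncvar (Vert v)) f z"
    by (simp add: sum_fun_apply act_Vert)
qed

lemma act_rels:
  assumes r: "r \<in> leavitt_rels TYPE('k::field) G" and f: "f \<in> Fin points"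
  shows "act \<tau> r f = 0"
proof -
  note act_alg = act_diff act_mult act_sum act_one
  have vert: "act \<tau> (ncvar (Vert v) * ncvar (Vert w) - (if v = w then ncvar (Vert v) else 0)) f = 0"
    if "v \<in> verts G" "w \<in> verts G" for v w
    using that disjoint by (auto simp: act_alg fun_eq_iff act_Vert)
  have src: "act \<tau> (ncvar (Vert (gen_src G x)) * ncvar x - ncvar x) f = 0"
    and tgt: "act \<tau> (ncvar x * ncvar (Vert (gen_tgt G x)) - ncvar x) f = 0"
    if "x \<in> leavitt_gens G" for x
    using that by (simp_all add: act_alg act_src act_tgt)
  have ck1: "act \<tau> (ncvar (Ghost e) * ncvar (Arc d) - (if e = d then ncvar (Vert (head G e)) else 0)) f = 0"
    if "e \<in> arcs G" "d \<in> arcs G" for e d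
    using that by (auto simp: act_alg fun_eq_iff act_Ghost_Arc act_Vert)
  have ck2: "act \<tau> (ncvar (Vert v) - (\<Sum>e \<in> out_arcs G v. ncvar (Arc e) * ncvar (Ghost e))) f = 0"
    if "v \<in> verts G" "out_arcs G v \<noteq> {}" for v
    using that by (simp add: act_alg sum_act_arcs)
  have unit: "act \<tau> (1 - (\<Sum>v \<in> verts G. ncvar (Vert v))) f = 0"
    by (simp add: act_alg sum_act_verts f)
  have gens: "x \<in> Arc ` arcs G \<Longrightarrow> x \<in> leavitt_gens G" "x \<in> Ghost ` arcs G \<Longrightarrow> x \<in> leavitt_gens G" for x
    by (auto simp: leavitt_gens_def)
  from r show ?thesis
    unfolding leavitt_rels_def
    by (elim UnE CollectE exE conjE singletonE; simp only: vert src tgt ck1 ck2 unit gens not_False_eq_True)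
qed

lemma ideal_in_kernel:
  "leavitt_ideal TYPE('k::field) G \<subseteq> fin_rep.rep_kernel (free_algebra TYPE('k) (leavitt_gens G)) points (act \<tau>)"
proof -
  interpret F: fin_rep "free_algebra TYPE('k) (leavitt_gens G)" points "act \<tau>"
    by (rule free_rep)
  have "leavitt_rels TYPE('k) G \<subseteq> F.rep_kernel"
    unfolding F.rep_kernel_def
    by (intro subsetI CollectI conjI ballI subsetD[OF leavitt_rels_carrier[OF fin_digraph]] act_rels)
  then show ?thesis
    unfolding leavitt_ideal_def by (rule F.genideal_minimal[OF F.rep_kernel_ideal])
qed

definition "rep c = act \<tau> (SOME p. p \<in> carrier (free_algebra TYPE('k::field) (leavitt_gens G)) \<and> cls G p = c)"

lemma leavitt_rep: "fin_rep (leavitt_path_algebra TYPE('k::field) G) points rep"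
  and rep_cls: "p \<in> carrier (free_algebra TYPE('k::field) (leavitt_gens G)) \<Longrightarrow> f \<in> Fin points \<Longrightarrow>
    rep (cls G p) f = act \<tau> p f"
proof -
  interpret F: fin_rep "free_algebra TYPE('k) (leavitt_gens G)" points "act \<tau>"
    by (rule free_rep)
  note * = F.quotient_rep[OF leavitt_ideal_ideal[OF fin_digraph] ideal_in_kernel]
  show "fin_rep (leavitt_path_algebra TYPE('k) G) points rep"
    using *(1) by (simp add: leavitt_path_algebra_def rep_def[abs_def] cls_def)
  show "rep (cls G p) f = act \<tau> p f"
    if "p \<in> carrier (free_algebra TYPE('k::field) (leavitt_gens G))" "f \<in> Fin points"
    using *(2)[OF that] by (simp add: rep_def cls_def)
qed

lemma vert_nonzero:
  assumes v: "v \<in> verts G" "X v \<noteq> {}"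
  shows "cls G (ncvar (Vert v)) \<noteq> \<zero>\<^bsub>leavitt_path_algebra TYPE('k::field) G\<^esub>"
proof
  interpret A: leavitt_hom G "leavitt_path_algebra TYPE('k) G" "cls G"
    by (rule leavitt_hom_cls fin_digraph)+
  interpret R: fin_rep "leavitt_path_algebra TYPE('k) G" points rep by (rule leavitt_rep)
  assume "cls G (ncvar (Vert v)) = \<zero>\<^bsub>leavitt_path_algebra TYPE('k) G\<^esub>"
  moreover obtain x where x: "x \<in> X v" using v by auto
  then have d: "delta x \<in> Fin points" using v by auto
  ultimately have "act \<tau> (ncvar (Vert v)) (delta x :: 'x \<Rightarrow> 'k) = 0"
    using R.rep_zero[OF d] rep_cls[OF A.gen_in_FA(1)[OF v(1)] d] by simp
  then have "act \<tau> (ncvar (Vert v)) (delta x :: 'x \<Rightarrow> 'k) x = 0" by simp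
  then show False using x by (simp add: act_Vert)
qed

end

section \<open>Finite-dimensional quotients\<close>

text \<open>Only cardinalities matter: any choice of one bijection per vertex that is not a sink can
  be cut up into the maps \<open>\<phi> e\<close>.\<close>

lemma branching_exists:
  assumes "fin_digraph G"
    and disj: "\<And>v w x. v \<in> verts G \<Longrightarrow> w \<in> verts G \<Longrightarrow> x \<in> X v \<Longrightarrow> x \<in> X w \<Longrightarrow> v = w"
    and bij: "\<And>v. v \<in> verts G \<Longrightarrow> out_arcs G v \<noteq> {} \<Longrightarrow>
      \<exists>b. bij_betw b (SIGMA e:out_arcs G v. X (head G e)) (X v)"
  shows "\<exists>\<phi>. branching G X \<phi>"
proof -
  interpret fin_digraph G by fact
  have "\<forall>v. \<exists>b. v \<in> verts G \<longrightarrow> out_arcs G v \<noteq> {} \<longrightarrow> bij_betw b (SIGMA e:out_arcs G v. X (head G e)) (X v)"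
    using bij by blast
  from choice[OF this] obtain b where b: "\<And>v. v \<in> verts G \<Longrightarrow> out_arcs G v \<noteq> {} \<Longrightarrow>
      bij_betw (b v) (SIGMA e:out_arcs G v. X (head G e)) (X v)"
    by blast
  have "branching G X (\<lambda>e x. b (tail G e) (e, x))"
  proof
    fix v assume v: "v \<in> verts G" "out_arcs G v \<noteq> {}"
    show "bij_betw (\<lambda>(e, x). b (tail G e) (e, x)) (SIGMA e:out_arcs G v. X (head G e)) (X v)"
      by (rule iffD1[OF bij_betw_cong b[OF v]]) auto
  qed (use disj in blast)
  then show ?thesis by blast
qed

text \<open>A countably infinite set at every vertex always works, because a nonempty finite
  disjoint union of countably infinite sets is again countably infinite.\<close>

lemma leavitt_vert_nonzero:
  assumes "fin_digraph G" and v: "v \<in> verts G"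
  shows "cls G (ncvar (Vert v)) \<noteq> \<zero>\<^bsub>leavitt_path_algebra TYPE('k::field) G\<^esub>"
proof -
  interpret fin_digraph G by fact
  define X where "X w = {w} \<times> (UNIV :: nat set)" for w :: 'a
  have "\<exists>b. bij_betw b (SIGMA e:out_arcs G w. X (head G e)) (X w)" if ne: "out_arcs G w \<noteq> {}" for w
  proof -
    let ?S = "SIGMA e:out_arcs G w. X (head G e)"
    have "finite (out_arcs G w)"
      by (rule finite_subset[OF _ finite_arcs]) auto
    then have countable: "countable ?S"
      by (rule countable_SIGMA[OF countable_finite]) (simp_all add: X_def)
    obtain e where e: "e \<in> out_arcs G w" using ne by blast
    have "range (\<lambda>n :: nat. (e, head G e, n)) \<subseteq> ?S"
      using e by (auto simp: X_def)
    moreover have "infinite (range (\<lambda>n :: nat. (e, head G e, n)))"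
      by (rule range_inj_infinite) (simp add: inj_def)
    ultimately have "infinite ?S" by (rule infinite_super)
    with countable obtain b where "bij_betw b ?S (UNIV :: nat set)"
      by (rule countableE_infinite)
    moreover have "bij_betw (Pair w) (UNIV :: nat set) (X w)"
      by (auto simp: X_def bij_betw_def inj_on_def)
    ultimately show ?thesis
      using bij_betw_trans by blast
  qed
  then obtain \<phi> where "branching G X \<phi>"
    using branching_exists[OF assms(1), of X] by (auto simp: X_def)
  then interpret branching G X \<phi> .
  show ?thesis
    by (rule vert_nonzero[OF v]) (auto simp: X_def)
qed

context leavitt_hom begin

lemma finite_dimension_of_finite_words:
  assumes K: "subfield (range \<kappa>) B"
    and fin: "finite ((\<lambda>w. h (Poly_Mapping.single w 1)) ` {w. set (letters w) \<subseteq> leavitt_gens G})"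
      (is "finite ?W")
  shows "\<exists>Us. set Us \<subseteq> carrier B \<and> h ` FA \<subseteq> B.Span (range \<kappa>) Us"
proof -
  have mono: "Poly_Mapping.single w c \<in> FA" if "set (letters w) \<subseteq> leavitt_gens G" for w and c :: 'k
    using that by (auto simp: free_algebra_def)
  obtain Us where Us: "set Us = ?W" using finite_list[OF fin] by blast
  have c: "set Us \<subseteq> carrier B"
    unfolding Us using mono h_closed by auto
  have span: "h (\<Sum>w\<in>T. Poly_Mapping.single w (c w)) \<in> B.Span (range \<kappa>) Us"
    if "finite T" "\<And>w. w \<in> T \<Longrightarrow> set (letters w) \<subseteq> leavitt_gens G" for T c
    using that
  proof (induction T)
    case empty
    then show ?case using B.Span_subgroup_props(2)[OF K c] by (simp add: h_zero)
  next
    case (insert w T)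
    have w: "set (letters w) \<subseteq> leavitt_gens G" using insert by simp
    have "Poly_Mapping.single w (c w) = ncconst (c w) * Poly_Mapping.single w 1"
      by (simp add: ncconst_def mult_single)
    then have "h (Poly_Mapping.single w (c w)) = \<kappa> (c w) \<otimes> h (Poly_Mapping.single w 1)"
      using mono[OF w] by (simp add: h_mult free_algebra_closed \<kappa>_def)
    moreover have "h (Poly_Mapping.single w 1) \<in> B.Span (range \<kappa>) Us"
      using B.Span_base_incl[OF K c] w Us by auto
    ultimately have "h (Poly_Mapping.single w (c w)) \<in> B.Span (range \<kappa>) Us"
      using B.Span_smult_closed[OF K c] by simp
    moreover have "h (\<Sum>w\<in>T. Poly_Mapping.single w (c w)) \<in> B.Span (range \<kappa>) Us"
      using insert by simp
    moreover have "(\<Sum>w\<in>T. Poly_Mapping.single w (c w)) \<in> FA"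
      using insert mono by (intro free_algebra_closed) auto
    ultimately show ?case
      using insert mono[OF w] B.Span_subgroup_props(3)[OF K c] by (simp add: h_add)
  qed
  have "h p \<in> B.Span (range \<kappa>) Us" if p: "p \<in> FA" for p
  proof -
    have "p = (\<Sum>w\<in>Poly_Mapping.keys p. Poly_Mapping.single w (Poly_Mapping.lookup p w))"
      by (rule poly_mapping_eqI)
        (simp add: lookup_sum lookup_single when_def in_keys_iff sum.delta')
    then show ?thesis
      using span[of "Poly_Mapping.keys p" "Poly_Mapping.lookup p"] p by (auto simp: free_algebra_def)
  qed
  then show ?thesis using c by blast
qed

end

context branching begin

text \<open>The quotient by the annihilator of the representation need not be identified. Words act
  by partial maps of a finite set of points, of which there are finitely many, so finitely many
  monomials span it.\<close>

lemma has_nonzero_fd_quotient: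
  assumes fin: "\<And>v. v \<in> verts G \<Longrightarrow> finite (X v)" and ne: "points \<noteq> {}"
  shows "has_nonzero_fd_quotient (leavitt_scalars TYPE('k::field) G) (leavitt_path_algebra TYPE('k) G)"
proof -
  let ?A = "leavitt_path_algebra TYPE('k) G"
  interpret A: leavitt_hom G ?A "cls G :: (('v, 'e) leavitt_gen, 'k) ncpoly \<Rightarrow> _"
    by (rule leavitt_hom_cls fin_digraph)+
  interpret R: fin_rep ?A points "rep :: _ \<Rightarrow> ('x \<Rightarrow> 'k) \<Rightarrow> _" by (rule leavitt_rep)
  define I where "I = R.rep_kernel"
  have I: "ideal I ?A" unfolding I_def by (rule R.rep_kernel_ideal)
  interpret I: ideal I ?A by (rule I)
  interpret Q: leavitt_hom G "?A Quot I" "\<lambda>p :: (('v, 'e) leavitt_gen, 'k) ncpoly. I +>\<^bsub>?A\<^esub> cls G p"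
    by (rule leavitt_hom_quotient[OF fin_digraph I])
  have scalars: "(\<lambda>c. I +>\<^bsub>?A\<^esub> c) ` leavitt_scalars TYPE('k) G = range Q.\<kappa>"
    by (auto simp: leavitt_scalars_eq Q.\<kappa>_def)
  \<comment> \<open>The unit fixes the basis vector at any point, so it does not lie in the
    annihilator.\<close>
  have one: "\<one>\<^bsub>?A Quot I\<^esub> \<noteq> \<zero>\<^bsub>?A Quot I\<^esub>"
  proof
    assume "\<one>\<^bsub>?A Quot I\<^esub> = \<zero>\<^bsub>?A Quot I\<^esub>"
    then have "I +>\<^bsub>?A\<^esub> \<one>\<^bsub>?A\<^esub> = I +>\<^bsub>?A\<^esub> \<zero>\<^bsub>?A\<^esub>"
      by (simp add: FactRing_def I.a_rcos_const I.zero_closed)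
    then have "\<one>\<^bsub>?A\<^esub> \<ominus>\<^bsub>?A\<^esub> \<zero>\<^bsub>?A\<^esub> \<in> I"
      using A.B.minus_in_ideal_iff[OF I, of "\<one>\<^bsub>?A\<^esub>" "\<zero>\<^bsub>?A\<^esub>"] by simp
    then have "\<one>\<^bsub>?A\<^esub> \<in> I" by (simp add: A.B.minus_eq)
    moreover obtain x where x: "x \<in> points" using ne by blast
    then have d: "(delta x :: 'x \<Rightarrow> 'k) \<in> Fin points" by simp
    ultimately have "(delta x :: 'x \<Rightarrow> 'k) = 0"
      using R.rep_one[OF d] d unfolding I_def R.rep_kernel_def by auto
    then have "(delta x :: 'x \<Rightarrow> 'k) x = 0" by simp
    then show False by simp
  qed
  have K: "subfield (range Q.\<kappa>) (?A Quot I)" by (rule Q.kappa_subfield[OF one])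
  let ?h = "\<lambda>w. I +>\<^bsub>?A\<^esub> cls G (Poly_Mapping.single w (1 :: 'k))"
  let ?W = "{w. set (letters w) \<subseteq> leavitt_gens G}"
  let ?r = "\<lambda>w. restrict (run \<tau> (letters w)) points"
  \<comment> \<open>Modulo \<open>I\<close> a monomial is determined by its partial map on the
    points, since off the points every pullback of a function in \<open>Fin points\<close>
    vanishes.\<close>
  have hr: "?h w = ?h w'" if w: "w \<in> ?W" "w' \<in> ?W" and eq: "?r w = ?r w'" for w w'
  proof -
    have F: "Poly_Mapping.single w (1 :: 'k) \<in> A.FA" "Poly_Mapping.single w' (1 :: 'k) \<in> A.FA"
      using w by (auto simp: free_algebra_def)
    have "act \<tau> (Poly_Mapping.single w 1) f = act \<tau> (Poly_Mapping.single w' 1) f"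
      if f: "f \<in> Fin points" for f :: "'x \<Rightarrow> 'k"
    proof
      fix z
      have "pull (run \<tau> (letters w)) f z = pull (run \<tau> (letters w')) f z"
      proof (cases "z \<in> points")
        case True
        then have "run \<tau> (letters w) z = run \<tau> (letters w') z"
          using fun_cong[OF eq, of z] by (simp only: restrict_apply if_True)
        then show ?thesis by (simp add: pull_def)
      next
        case False
        have "pull (run \<tau> (letters u)) f z = 0" if "u \<in> ?W" for u
          using that False run_points[of "letters u" z] f
          by (auto simp: pull_def Fin_def split: option.split)
        then show ?thesis using w by simp
      qed
      then show "act \<tau> (Poly_Mapping.single w 1) f z = act \<tau> (Poly_Mapping.single w' 1) f z"
        by (simp add: act_single fscale_apply)
    qed
    then have "rep (cls G (Poly_Mapping.single w 1) \<ominus>\<^bsub>?A\<^esub> cls G (Poly_Mapping.single w' 1)) f = 0"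
      if "f \<in> Fin points" for f :: "'x \<Rightarrow> 'k"
      using that F by (simp add: A.B.minus_eq R.rep_add R.rep_uminus rep_cls A.h_closed)
    then have "cls G (Poly_Mapping.single w (1 :: 'k)) \<ominus>\<^bsub>?A\<^esub> cls G (Poly_Mapping.single w' 1) \<in> I"
      unfolding I_def R.rep_kernel_def
      using A.B.minus_closed[OF A.h_closed[OF F(1)] A.h_closed[OF F(2)]] by simp
    then show ?thesis
      using A.B.minus_in_ideal_iff[OF I A.h_closed[OF F(1)] A.h_closed[OF F(2)]] by simp
  qed
  have "?r ` ?W \<subseteq> points \<rightarrow>\<^sub>E insert None (Some ` points)"
  proof (rule image_subsetI)
    fix w assume w: "w \<in> ?W"
    have "run \<tau> (letters w) z \<in> insert None (Some ` points)" if "z \<in> points" for z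
      using w that run_points[of "letters w" z] by (cases "run \<tau> (letters w) z") auto
    then show "?r w \<in> points \<rightarrow>\<^sub>E insert None (Some ` points)"
      unfolding restrict_PiE_iff by (rule ballI)
  qed
  moreover have "finite (points \<rightarrow>\<^sub>E insert None (Some ` points))"
    using fin by (intro finite_PiE) auto
  ultimately have "finite (?r ` ?W)" by (rule finite_subset)
  moreover have "?h ` ?W \<subseteq> (\<lambda>m. ?h (SOME w. w \<in> ?W \<and> ?r w = m)) ` ?r ` ?W"
  proof (rule image_subsetI)
    fix w assume w: "w \<in> ?W"
    let ?w' = "SOME w'. w' \<in> ?W \<and> ?r w' = ?r w"
    have "?w' \<in> ?W \<and> ?r ?w' = ?r w" by (rule someI[of _ w]) (use w in simp)
    then have "?h w = ?h ?w'" using w by (intro hr) auto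
    then show "?h w \<in> (\<lambda>m. ?h (SOME w. w \<in> ?W \<and> ?r w = m)) ` ?r ` ?W"
      using w by (intro image_eqI[of _ _ "?r w"]) auto
  qed
  ultimately have "finite (?h ` ?W)"
    by (meson finite_imageI finite_subset)
  from Q.finite_dimension_of_finite_words[OF K this] obtain Us where Us:
    "set Us \<subseteq> carrier (?A Quot I)" "(\<lambda>p. I +>\<^bsub>?A\<^esub> cls G p) ` A.FA \<subseteq> Q.B.Span (range Q.\<kappa>) Us"
    by auto
  have "carrier (?A Quot I) = (\<lambda>p. I +>\<^bsub>?A\<^esub> cls G p) ` A.FA"
    using carrier_leavitt[of G, where 'k = 'k] by (auto simp: FactRing_def A_RCOSETS_def')
  then have "Q.B.Span (range Q.\<kappa>) Us = carrier (?A Quot I)"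
    using Us(2) Q.B.Span_subgroup_props(1)[OF K Us(1)] by (intro antisym) auto
  then have "Q.B.finite_dimension (range Q.\<kappa>) (carrier (?A Quot I))"
    using Q.B.Span_finite_dimension[OF K Us(1)] by simp
  moreover have "carrier (?A Quot I) \<noteq> {\<zero>\<^bsub>?A Quot I\<^esub>}"
    using one Q.B.one_closed by auto
  ultimately show ?thesis
    unfolding has_nonzero_fd_quotient_def using I scalars by auto
qed

end

section \<open>Invariant basis number\<close>

lemma fd_quotient_of_harmonic:
  fixes d :: "'v \<Rightarrow> nat"
  assumes G: "fin_digraph (G :: ('v, 'e) pre_digraph)"
    and d: "\<And>v. v \<in> verts G \<Longrightarrow> out_arcs G v \<noteq> {} \<Longrightarrow> d v = (\<Sum>e\<in>out_arcs G v. d (head G e))"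
    and ne: "w \<in> verts G" "d w \<noteq> 0"
  shows "has_nonzero_fd_quotient (leavitt_scalars TYPE('k::field) G) (leavitt_path_algebra TYPE('k) G)"
proof -
  interpret fin_digraph G by fact
  define X where "X v = {v} \<times> {..<d v}" for v
  have "\<exists>b. bij_betw b (SIGMA e:out_arcs G v. X (head G e)) (X v)"
    if v: "v \<in> verts G" "out_arcs G v \<noteq> {}" for v
  proof (rule finite_same_card_bij)
    have fin: "finite (out_arcs G v)"
      by (rule finite_subset[OF _ finite_arcs]) auto
    then show "finite (SIGMA e:out_arcs G v. X (head G e))"
      by (auto simp: X_def)
    show "card (SIGMA e:out_arcs G v. X (head G e)) = card (X v)"
      using fin d[OF v] by (simp add: X_def card_cartesian_product)
  qed (simp add: X_def)
  then obtain \<phi> where "branching G X \<phi>"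
    using branching_exists[OF G, of X] by (auto simp: X_def)
  then interpret branching G X \<phi> .
  show ?thesis
    by (rule has_nonzero_fd_quotient) (use ne in \<open>auto simp: X_def\<close>)
qed

section \<open>Branching systems that differ in finitely many points\<close>

lemma pull_delta: "pull t (delta x) z = (if t z = Some x then 1 else 0)"
  by (auto simp: pull_def delta_def split: option.split)

text \<open>Disagreement is measured at the end point \<open>y\<close> because the pullback of
  \<open>delta y\<close> is the indicator of the fibre over \<open>y\<close>. Either the rest of the
  word already disagrees at \<open>y\<close>, or \<open>y\<close> is reached by the rest of the word
  from one of the finitely many points where the first letter disagrees.\<close>

lemma finite_run_disagreement:
  assumes "\<And>g. g \<in> A \<Longrightarrow> finite {y. \<exists>z. (\<sigma> g z = Some y) \<noteq> (\<tau> g z = Some y)}" "set w \<subseteq> A"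
  shows "finite {y. \<exists>z. (run \<sigma> w z = Some y) \<noteq> (run \<tau> w z = Some y)}"
  using assms(2)
proof (induction w)
  case (Cons g w)
  let ?D = "{y. \<exists>z. (\<sigma> g z = Some y) \<noteq> (\<tau> g z = Some y)}"
  have "{y. \<exists>z. (run \<sigma> (g # w) z = Some y) \<noteq> (run \<tau> (g # w) z = Some y)}
      \<subseteq> {y. \<exists>z. (run \<sigma> w z = Some y) \<noteq> (run \<tau> w z = Some y)}
        \<union> (\<lambda>y. the (run \<sigma> w y)) ` ?D \<union> (\<lambda>y. the (run \<tau> w y)) ` ?D" (is "?L \<subseteq> ?R")
  proof
    fix x assume "x \<in> ?L"
    then obtain z where z: "(run \<sigma> (g # w) z = Some x) \<noteq> (run \<tau> (g # w) z = Some x)" by blast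
    show "x \<in> ?R"
    proof (cases "run \<sigma> (g # w) z = Some x")
      case True
      then obtain y where y: "\<sigma> g z = Some y" "run \<sigma> w y = Some x"
        by (auto simp: bind_eq_Some_conv)
      show ?thesis
      proof (cases "\<tau> g z = Some y")
        case True
        then have "run \<tau> w y \<noteq> Some x" using z y by auto
        then show ?thesis using y by auto
      next
        case False
        then have "y \<in> ?D" using y by auto
        then show ?thesis using y by force
      qed
    next
      case False
      then have "run \<tau> (g # w) z = Some x" using z by simp
      then obtain y where y: "\<tau> g z = Some y" "run \<tau> w y = Some x"
        by (auto simp: bind_eq_Some_conv)
      show ?thesis
      proof (cases "\<sigma> g z = Some y")
        case True
        then have "run \<sigma> w y \<noteq> Some x" using z y by auto
        then show ?thesis using y by auto
      next
        case False
        then have "y \<in> ?D" using y by auto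
        then show ?thesis using y by force
      qed
    qed
  qed
  moreover have "finite ?R"
    using Cons assms(1)[of g] by auto
  ultimately show ?case by (rule finite_subset)
qed simp

text \<open>Since \<open>\<phi>\<close> is shared, the steps can differ only at points of the
  symmetric difference of \<open>X v\<close> and \<open>X' v\<close>, or for a ghost at their images
  under \<open>\<phi> e\<close>.\<close>

lemma (in branching) finite_step_disagreement:
  assumes X': "branching G X' \<phi>"
    and fin: "\<And>v. v \<in> verts G \<Longrightarrow> finite (X v - X' v)" "\<And>v. v \<in> verts G \<Longrightarrow> finite (X' v - X v)"
    and g: "g \<in> leavitt_gens G"
  shows "finite {y. \<exists>z. (branch_step G X \<phi> g z = Some y) \<noteq> (branch_step G X' \<phi> g z = Some y)}"
proof -
  interpret B: branching G X' \<phi> by fact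
  let ?\<Delta> = "\<lambda>v. (X v - X' v) \<union> (X' v - X v)"
  let ?D = "{y. \<exists>z. (branch_step G X \<phi> g z = Some y) \<noteq> (branch_step G X' \<phi> g z = Some y)}"
  have \<Delta>: "finite (?\<Delta> v)" if "v \<in> verts G" for v using fin that by simp
  show ?thesis
  proof (cases g)
    case (Vert v)
    then have "v \<in> verts G" using g by (auto simp: leavitt_gens_def)
    moreover have "?D \<subseteq> ?\<Delta> v" unfolding Vert by auto
    ultimately show ?thesis using \<Delta> finite_subset by blast
  next
    case (Arc e)
    then have e: "e \<in> arcs G" using g by (auto simp: leavitt_gens_def)
    have "?D \<subseteq> ?\<Delta> (head G e)"
      unfolding Arc using step_Arc_iff[OF e] B.step_Arc_iff[OF e] by (auto simp del: branch_step.simps)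
    then show ?thesis using \<Delta>[of "head G e"] e finite_subset by auto
  next
    case (Ghost e)
    then have e: "e \<in> arcs G" using g by (auto simp: leavitt_gens_def)
    have "?D \<subseteq> \<phi> e ` ?\<Delta> (head G e)" unfolding Ghost by (auto split: if_splits)
    moreover have "finite (\<phi> e ` ?\<Delta> (head G e))" using \<Delta>[of "head G e"] e by simp
    ultimately show ?thesis by (rule finite_subset)
  qed
qed

text \<open>Only the unions are nested. At a single vertex either set may be the larger one, which
  is how a harmonic function with entries of both signs is realised.\<close>

theorem IBN_of_almost_equal_branchings:
  fixes G :: "('v, 'e) pre_digraph" and X X' :: "'v \<Rightarrow> 'x set"
  assumes "branching G X \<phi>" "branching G X' \<phi>"
    and fin: "\<And>v. v \<in> verts G \<Longrightarrow> finite (X v - X' v)" "\<And>v. v \<in> verts G \<Longrightarrow> finite (X' v - X v)"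
    and sub: "(\<Union>v\<in>verts G. X v) \<subset> (\<Union>v\<in>verts G. X' v)"
  shows "IBN (leavitt_path_algebra TYPE('k::field) G)"
proof -
  interpret A: branching G X \<phi> by fact
  interpret B: branching G X' \<phi> by fact
  show ?thesis
  proof (rule IBN_criterion[OF A.leavitt_rep B.leavitt_rep])
    show "A.points \<subseteq> B.points" "A.points \<noteq> B.points" using sub by auto
    have "B.points - A.points \<subseteq> (\<Union>v\<in>verts G. X' v - X v)" by auto
    moreover have "finite (\<Union>v\<in>verts G. X' v - X v)" using fin by simp
    ultimately show "finite (B.points - A.points)" by (rule finite_subset)
    fix a assume "a \<in> carrier (leavitt_path_algebra TYPE('k) G)"
    then obtain p where p: "a = cls G p" "p \<in> carrier (free_algebra TYPE('k) (leavitt_gens G))"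
      unfolding carrier_leavitt by (rule imageE)
    let ?D = "\<lambda>w. {y. \<exists>z. (run A.\<tau> w z = Some y) \<noteq> (run B.\<tau> w z = Some y)}"
    let ?U = "\<Union>w\<in>Poly_Mapping.keys p. ?D (letters w)"
    have "finite (?D (letters w))" if "w \<in> Poly_Mapping.keys p" for w
      using p(2) that A.finite_step_disagreement[OF assms(2) fin]
      by (intro finite_run_disagreement[where A = "leavitt_gens G"]) (auto simp: free_algebra_def)
    then have "finite ?U" by simp
    moreover have "{x \<in> A.points. A.rep a (delta x :: 'x \<Rightarrow> 'k) \<noteq> B.rep a (delta x)} \<subseteq> ?U"
    proof
      fix x assume x: "x \<in> {x \<in> A.points. A.rep a (delta x :: 'x \<Rightarrow> 'k) \<noteq> B.rep a (delta x)}"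
      then have "x \<in> A.points" "x \<in> B.points" using sub by auto
      then have "A.rep a (delta x :: 'x \<Rightarrow> 'k) = act A.\<tau> p (delta x)"
        "B.rep a (delta x :: 'x \<Rightarrow> 'k) = act B.\<tau> p (delta x)"
        unfolding p(1) by (intro A.rep_cls B.rep_cls p(2); simp)+
      with x have neq: "act A.\<tau> p (delta x :: 'x \<Rightarrow> 'k) \<noteq> act B.\<tau> p (delta x)" by simp
      show "x \<in> ?U"
      proof (rule ccontr)
        assume "x \<notin> ?U"
        then have "pull (run A.\<tau> (letters w)) (delta x :: 'x \<Rightarrow> 'k) = pull (run B.\<tau> (letters w)) (delta x)"
          if "w \<in> Poly_Mapping.keys p" for w
          using that by (auto simp: pull_delta fun_eq_iff)
        then show False using neq unfolding act_def by simp
      qed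
    qed
    ultimately show "finite {x \<in> A.points. A.rep a (delta x :: 'x \<Rightarrow> 'k) \<noteq> B.rep a (delta x)}"
      by (rule rev_finite_subset)
  qed
qed

section \<open>Coordinates in a finite-dimensional target\<close>

context leavitt_hom begin

text \<open>Takes coefficients as a function rather than a list, so that a basis identifies the ring
  with a space \<open>Fin {..<n}\<close>, the form in which \<open>fin_rep\<close> expects a
  representation.\<close>

definition vec :: "'b list \<Rightarrow> (nat \<Rightarrow> 'k) \<Rightarrow> 'b" where
  "vec Vs f = B.combine (map (\<lambda>i. \<kappa> (f i)) [0..<length Vs]) Vs"

lemma vec_closed: "set Vs \<subseteq> carrier B \<Longrightarrow> vec Vs f \<in> carrier B"
  unfolding vec_def by (intro B.combine_in_carrier) auto

lemma vec_add: "set Vs \<subseteq> carrier B \<Longrightarrow> vec Vs (f + g) = vec Vs f \<oplus> vec Vs g"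
proof -
  assume Vs: "set Vs \<subseteq> carrier B"
  have "map2 (\<oplus>) (map (\<lambda>i. \<kappa> (f i)) l) (map (\<lambda>i. \<kappa> (g i)) l) = map (\<lambda>i. \<kappa> ((f + g) i)) l" for l
    by (induction l) (simp_all add: kappa_simps)
  then show ?thesis
    unfolding vec_def using Vs by (subst B.combine_add) auto
qed

lemma vec_scale: "set Vs \<subseteq> carrier B \<Longrightarrow> vec Vs (fscale c f) = \<kappa> c \<otimes> vec Vs f"
  unfolding vec_def by (subst B.combine_r_distr) (auto simp: kappa_simps fscale_apply comp_def)

lemma vec_bij:
  assumes K: "subfield (range \<kappa>) B" and one: "\<one> \<noteq> \<zero>"
    and Vs: "B.independent (range \<kappa>) Vs" "B.Span (range \<kappa>) Vs = carrier B"
  shows "bij_betw (vec Vs) (Fin {..<length Vs}) (carrier B)"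
  unfolding bij_betw_def
proof
  have c: "set Vs \<subseteq> carrier B" by (rule B.independent_in_carrier[OF Vs(1)])
  have unique: "\<exists>!Ks. set Ks \<subseteq> range \<kappa> \<and> length Ks = length Vs \<and> a = B.combine Ks Vs"
    if "a \<in> carrier B" for a
    using B.unique_decomposition[OF K Vs(1)] that Vs(2) by simp
  show "inj_on (vec Vs) (Fin {..<length Vs})"
  proof (rule inj_onI, rule ext)
    fix f g i assume fg: "f \<in> Fin {..<length Vs}" "g \<in> Fin {..<length Vs}" "vec Vs f = vec Vs g"
    have "map (\<lambda>i. \<kappa> (f i)) [0..<length Vs] = map (\<lambda>i. \<kappa> (g i)) [0..<length Vs]"
      (is "?f = ?g")
    proof -
      have "set ?f \<subseteq> range \<kappa> \<and> length ?f = length Vs \<and> vec Vs f = B.combine ?f Vs"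
        by (auto simp: vec_def)
      moreover have "set ?g \<subseteq> range \<kappa> \<and> length ?g = length Vs \<and> vec Vs f = B.combine ?g Vs"
        unfolding fg(3) by (auto simp: vec_def)
      moreover obtain L where "\<And>Ks. set Ks \<subseteq> range \<kappa> \<and> length Ks = length Vs \<and>
          vec Vs f = B.combine Ks Vs \<Longrightarrow> Ks = L"
        using unique[OF vec_closed[OF c, of f]] by (elim ex1E) blast
      ultimately show ?thesis by metis
    qed
    then have "f i = g i" if "i < length Vs"
      using that injD[OF kappa_inj[OF one], of "f i" "g i"] by simp
    moreover have "f i = 0" "g i = 0" if "\<not> i < length Vs"
      using that fg(1,2) by (auto simp: Fin_def subset_eq)
    ultimately show "f i = g i" by (cases "i < length Vs") simp_all
  qed
  show "vec Vs ` Fin {..<length Vs} = carrier B"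
  proof (intro antisym subsetI)
    fix a assume "a \<in> carrier B"
    from unique[OF this] obtain Ks where Ks: "set Ks \<subseteq> range \<kappa>" "length Ks = length Vs" "a = B.combine Ks Vs"
      by blast
    define f where "f i = (if i < length Vs then inv_into UNIV \<kappa> (Ks ! i) else 0)" for i
    have "map (\<lambda>i. \<kappa> (f i)) [0..<length Vs] = Ks"
      using Ks by (intro nth_equalityI) (auto simp: f_def f_inv_into_f subset_eq)
    then have "vec Vs f = a" by (simp add: vec_def Ks)
    moreover have "f \<in> Fin {..<length Vs}"
    proof -
      have "{x. f x \<noteq> 0} \<subseteq> {..<length Vs}" by (auto simp: f_def split: if_splits)
      then show ?thesis unfolding Fin_def by (auto intro: finite_subset)
    qed
    ultimately show "a \<in> vec Vs ` Fin {..<length Vs}" by blast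
  qed (use vec_closed[OF c] in auto)
qed

end

text \<open>The algebra acts on the quotient by left multiplication, written in coordinates. Against
  the representation on no points at all the agreement condition is vacuous, and s becomes the
  dimension of the quotient.\<close>

theorem IBN_of_fd_quotient:
  assumes G: "fin_digraph (G :: ('v, 'e) pre_digraph)"
    and fd: "has_nonzero_fd_quotient (leavitt_scalars TYPE('k::field) G) (leavitt_path_algebra TYPE('k) G)"
  shows "IBN (leavitt_path_algebra TYPE('k) G)"
proof -
  let ?A = "leavitt_path_algebra TYPE('k) G"
  from fd obtain I where I: "ideal I ?A" and nz: "carrier (?A Quot I) \<noteq> {\<zero>\<^bsub>?A Quot I\<^esub>}"
    and fin: "ring.finite_dimension (?A Quot I) ((\<lambda>c. I +>\<^bsub>?A\<^esub> c) ` leavitt_scalars TYPE('k) G) (carrier (?A Quot I))"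
    unfolding has_nonzero_fd_quotient_def by blast
  interpret A: leavitt_hom G ?A "cls G :: (('v, 'e) leavitt_gen, 'k) ncpoly \<Rightarrow> _"
    by (rule leavitt_hom_cls[OF G])
  interpret I: ideal I ?A by (rule I)
  interpret Q: leavitt_hom G "?A Quot I" "\<lambda>p :: (('v, 'e) leavitt_gen, 'k) ncpoly. I +>\<^bsub>?A\<^esub> cls G p"
    by (rule leavitt_hom_quotient[OF G I])
  have scalars: "(\<lambda>c. I +>\<^bsub>?A\<^esub> c) ` leavitt_scalars TYPE('k) G = range Q.\<kappa>"
    by (auto simp: leavitt_scalars_eq Q.\<kappa>_def)
  have one: "\<one>\<^bsub>?A Quot I\<^esub> \<noteq> \<zero>\<^bsub>?A Quot I\<^esub>"
    using nz by (rule contrapos_nn) (rule Q.B.one_zeroD)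
  have K: "subfield (range Q.\<kappa>) (?A Quot I)" by (rule Q.kappa_subfield[OF one])
  obtain n where n: "Q.B.dimension n (range Q.\<kappa>) (carrier (?A Quot I))"
    using fin unfolding scalars Q.B.finite_dimension_def by (rule exE)
  obtain Vs where base: "set Vs \<subseteq> carrier (?A Quot I) \<and> Q.B.independent (range Q.\<kappa>) Vs \<and>
      length Vs = n \<and> Q.B.Span (range Q.\<kappa>) Vs = carrier (?A Quot I)"
    using Q.B.exists_base[OF K n] by (rule exE)
  note Vs = base[THEN conjunct1] base[THEN conjunct2, THEN conjunct1]
    base[THEN conjunct2, THEN conjunct2, THEN conjunct2]
  have bij: "bij_betw (Q.vec Vs) (Fin {..<length Vs}) (carrier (?A Quot I))"
    by (rule Q.vec_bij[OF K one Vs(2,3)])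
  define co where "co = inv_into (Fin {..<length Vs}) (Q.vec Vs)"
  have co: "co b \<in> Fin {..<length Vs}" "Q.vec Vs (co b) = b" if "b \<in> carrier (?A Quot I)" for b
    using that bij by (auto simp: co_def bij_betw_def inv_into_into f_inv_into_f)
  have co_vec: "co (Q.vec Vs f) = f" if "f \<in> Fin {..<length Vs}" for f
    using that bij by (simp add: co_def bij_betw_def)
  note vec_closed = Q.vec_closed[OF Vs(1)]
  have co_add: "co (b \<oplus>\<^bsub>?A Quot I\<^esub> c) = co b + co c"
    if "b \<in> carrier (?A Quot I)" "c \<in> carrier (?A Quot I)" for b c
  proof -
    have "co b + co c \<in> Fin {..<length Vs}"
      by (intro fv.subspace_add[OF Fin_subspace] co that)
    from co_vec[OF this] show ?thesis
      unfolding Q.vec_add[OF Vs(1)] co(2)[OF that(1)] co(2)[OF that(2)] .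
  qed
  have co_scale: "co (Q.\<kappa> c \<otimes>\<^bsub>?A Quot I\<^esub> b) = fscale c (co b)"
    if "b \<in> carrier (?A Quot I)" for b c
  proof -
    have "fscale c (co b) \<in> Fin {..<length Vs}"
      by (intro fv.subspace_scale[OF Fin_subspace] co that)
    from co_vec[OF this] show ?thesis
      unfolding Q.vec_scale[OF Vs(1)] co(2)[OF that] .
  qed
  define \<rho> where "\<rho> a f = co ((I +>\<^bsub>?A\<^esub> a) \<otimes>\<^bsub>?A Quot I\<^esub> Q.vec Vs f)" for a f
  have coset: "I +>\<^bsub>?A\<^esub> a \<in> carrier (?A Quot I)" if "a \<in> carrier ?A" for a
    using ring_hom_closed[OF I.rcos_ring_hom that] .
  \<comment> \<open>Linearity of left multiplication over the ground field needs the scalars to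
    commute with \<open>a\<close>.\<close>
  have central: "(I +>\<^bsub>?A\<^esub> a) \<otimes>\<^bsub>?A Quot I\<^esub> (Q.\<kappa> c \<otimes>\<^bsub>?A Quot I\<^esub> b)
      = Q.\<kappa> c \<otimes>\<^bsub>?A Quot I\<^esub> ((I +>\<^bsub>?A\<^esub> a) \<otimes>\<^bsub>?A Quot I\<^esub> b)"
    if a: "a \<in> carrier ?A" and b: "b \<in> carrier (?A Quot I)" for a b c
  proof -
    obtain p where "a = cls G p" "p \<in> Q.FA"
      using a unfolding carrier_leavitt by (rule imageE)
    then have "Q.\<kappa> c \<otimes>\<^bsub>?A Quot I\<^esub> (I +>\<^bsub>?A\<^esub> a) = (I +>\<^bsub>?A\<^esub> a) \<otimes>\<^bsub>?A Quot I\<^esub> Q.\<kappa> c"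
      using Q.kappa_central[of p c] by simp
    then show ?thesis
      using b coset[OF a] by (simp flip: Q.B.m_assoc)
  qed
  have rep: "fin_rep ?A {..<length Vs} \<rho>"
  proof (rule fin_rep.intro[OF A.B.ring_axioms], rule fin_rep_axioms.intro)
    fix a assume a: "a \<in> carrier ?A"
    show "Vector_Spaces.linear fscale fscale (\<rho> a)"
      by unfold_locales
        (simp_all add: \<rho>_def Q.vec_add[OF Vs(1)] Q.vec_scale[OF Vs(1)] Q.B.r_distr coset[OF a]
          vec_closed co_add co_scale central[OF a])
  next
    fix a and f :: "nat \<Rightarrow> 'k" assume "a \<in> carrier ?A"
    then show "\<rho> a f \<in> Fin {..<length Vs}"
      unfolding \<rho>_def by (intro co Q.B.m_closed coset vec_closed)
  next
    fix a b and f :: "nat \<Rightarrow> 'k" assume ab: "a \<in> carrier ?A" "b \<in> carrier ?A"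
    then show "\<rho> (a \<oplus>\<^bsub>?A\<^esub> b) f = \<rho> a f + \<rho> b f"
      by (simp add: \<rho>_def ring_hom_add[OF I.rcos_ring_hom] Q.B.l_distr coset vec_closed co_add)
    from ab show "\<rho> (a \<otimes>\<^bsub>?A\<^esub> b) f = \<rho> a (\<rho> b f)"
      by (simp add: \<rho>_def ring_hom_mult[OF I.rcos_ring_hom] Q.B.m_assoc coset vec_closed co)
  next
    fix f :: "nat \<Rightarrow> 'k" assume "f \<in> Fin {..<length Vs}"
    then show "\<rho> \<one>\<^bsub>?A\<^esub> f = f"
      by (simp add: \<rho>_def ring_hom_one[OF I.rcos_ring_hom] vec_closed co_vec)
  qed
  have Fin_empty: "Fin {} = {0 :: nat \<Rightarrow> 'k}"
    by (auto simp: Fin_def)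
  have lin: "Vector_Spaces.linear fscale fscale (\<lambda>_ :: nat \<Rightarrow> 'k. 0 :: nat \<Rightarrow> 'k)"
    by unfold_locales simp_all
  have trivial: "fin_rep ?A {} (\<lambda>_ (_ :: nat \<Rightarrow> 'k). 0)"
    by (rule fin_rep.intro[OF A.B.ring_axioms], rule fin_rep_axioms.intro)
      (simp_all add: Fin_empty lin)
  have "length Vs \<noteq> 0"
  proof
    assume "length Vs = 0"
    then have "Q.B.Span (range Q.\<kappa>) Vs = {\<zero>\<^bsub>?A Quot I\<^esub>}" by simp
    then show False using Vs(3) nz by (simp only:)
  qed
  then show ?thesis
    by (intro IBN_criterion[OF trivial rep]) auto
qed

section \<open>Closed paths and growth\<close>

text \<open>By the hypothesis every vertex has at most one arc that leads back to it. So at a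
  non-sink vertex of the strong component \<open>C\<close> of \<open>w\<close> exactly one arc stays
  in \<open>C\<close> and the heads of the others do not reach \<open>w\<close>, which makes the
  value 1 on \<open>C\<close> consistent. Upstream of \<open>C\<close> there are no cycles, so the
  values there are determined by recursion.\<close>

lemma harmonic_exists:
  fixes G :: "('v, 'e) pre_digraph"
  assumes G: "fin_digraph G" and ne: "verts G \<noteq> {}"
    and unique: "\<And>v e f. e \<in> arcs G \<Longrightarrow> f \<in> arcs G \<Longrightarrow> tail G e = v \<Longrightarrow> tail G f = v \<Longrightarrow>
      (head G e, v) \<in> (arcs_ends G)\<^sup>* \<Longrightarrow> (head G f, v) \<in> (arcs_ends G)\<^sup>* \<Longrightarrow> e = f"
  shows "\<exists>d :: 'v \<Rightarrow> nat. (\<exists>w \<in> verts G. d w \<noteq> 0) \<and>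
    (\<forall>v \<in> verts G. out_arcs G v \<noteq> {} \<longrightarrow> d v = (\<Sum>e\<in>out_arcs G v. d (head G e)))"
proof -
  interpret fin_digraph G by fact
  define E where "E = arcs_ends G"
  have E_arc: "(tail G e, head G e) \<in> E" if "e \<in> arcs G" for e
    using that by (auto simp: E_def arcs_ends_conv)
  have finE: "finite E" by (simp add: E_def arcs_ends_conv)
  have E_tail: "\<exists>e \<in> out_arcs G u. v = head G e" if "(u, v) \<in> E" for u v
    using that by (auto simp: E_def arcs_ends_conv)
  have fin_out: "finite (out_arcs G v)" for v
    by (rule finite_subset[OF _ finite_arcs]) auto
  define T where "T = {v \<in> verts G. out_arcs G v = {} \<or> (v, v) \<in> E\<^sup>+}"
  have "T \<noteq> {}"
  proof (cases "acyclic E")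
    case True
    then have "wf (E\<inverse>)" using finE by (rule finite_acyclic_wf_converse[rotated])
    then obtain z where z: "z \<in> verts G" "\<And>y. (y, z) \<in> E\<inverse> \<Longrightarrow> y \<notin> verts G"
      using ne by (meson wfE_min ex_in_conv)
    have "out_arcs G z = {}"
      using z(2) E_arc head_in_verts by fastforce
    then show ?thesis using z(1) by (auto simp: T_def)
  next
    case False
    then obtain v where v: "(v, v) \<in> E\<^sup>+" by (auto simp: acyclic_def)
    then obtain u where "(v, u) \<in> E" by (auto dest: tranclD)
    then have "v \<in> verts G" by (auto simp: E_def arcs_ends_conv)
    then show ?thesis using v by (auto simp: T_def)
  qed
  \<comment> \<open>Strict reachability, a strict order. A minimal \<open>w\<close> in
    \<open>T\<close> is one that no cycle outside its own strong component can reach.\<close>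
  define S where "S = {(t, u). t \<in> verts G \<and> u \<in> verts G \<and> (t, u) \<in> E\<^sup>* \<and> (u, t) \<notin> E\<^sup>*}"
  have "wf S"
  proof (rule finite_acyclic_wf)
    show "finite S"
      by (rule finite_subset[of _ "verts G \<times> verts G"]) (auto simp: S_def)
    have "trans S"
      by (rule transI) (auto simp: S_def intro: rtrancl_trans)
    then show "acyclic S"
      by (auto simp: acyclic_def trancl_id) (auto simp: S_def)
  qed
  then obtain w where w: "w \<in> T" and min: "\<And>t. (t, w) \<in> S \<Longrightarrow> t \<notin> T"
    using \<open>T \<noteq> {}\<close> by (meson wfE_min ex_in_conv)
  then have wv: "w \<in> verts G" by (simp add: T_def)
  define C where "C = {v. (v, w) \<in> E\<^sup>* \<and> (w, v) \<in> E\<^sup>*}"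
  \<comment> \<open>The recursion runs from the head of an arc to its tail. A cycle of
    \<open>P\<close> would consist of vertices outside \<open>C\<close> that reach \<open>w\<close>,
    against the minimality of \<open>w\<close>.\<close>
  define P where "P = {(head G e, tail G e) | e. e \<in> arcs G \<and> tail G e \<notin> C \<and> (tail G e, w) \<in> E\<^sup>*}"
  have "P \<subseteq> E\<inverse>"
    using E_arc by (auto simp: P_def)
  have P_source: "v \<in> verts G \<and> v \<notin> C \<and> (v, w) \<in> E\<^sup>*" if "(u, v) \<in> P" for u v
    using that by (auto simp: P_def)
  have "wf P"
  proof (rule finite_acyclic_wf)
    show "finite P"
      using \<open>P \<subseteq> E\<inverse>\<close> finE finite_subset by auto
    show "acyclic P"
      unfolding acyclic_def
    proof (intro allI notI)
      fix v assume v: "(v, v) \<in> P\<^sup>+"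
      then obtain u where "(u, v) \<in> P" by (metis tranclD2)
      then have v': "v \<in> verts G" "v \<notin> C" "(v, w) \<in> E\<^sup>*" using P_source by auto
      have "(v, v) \<in> (E\<inverse>)\<^sup>+" using v \<open>P \<subseteq> E\<inverse>\<close> by (rule trancl_mono)
      then have "(v, v) \<in> E\<^sup>+" by (simp add: trancl_converse)
      then have "v \<in> T" using v' by (simp add: T_def)
      then have "(v, w) \<notin> S" using min by blast
      then have "(w, v) \<in> E\<^sup>*" using v' wv by (simp add: S_def)
      then show False using v' by (simp add: C_def)
    qed
  qed
  \<comment> \<open>Vertices that do not reach \<open>w\<close> are cut off with value 0, the number
    of paths from them to \<open>w\<close>. Cycles may occur among them, and there the recursion
    would not be founded.\<close>
  define H where "H f v = (if v \<in> C then 1 else if (v, w) \<notin> E\<^sup>* then 0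
      else \<Sum>e\<in>out_arcs G v. f (head G e))" for f :: "'v \<Rightarrow> nat" and v
  define d where "d = wfrec P H"
  have d: "d v = H d v" for v
  proof -
    have "d v = H (cut d P v) v"
      unfolding d_def by (rule wfrec[OF \<open>wf P\<close>])
    also have "\<dots> = H d v"
    proof -
      have "cut d P v (head G e) = d (head G e)"
        if "e \<in> out_arcs G v" "v \<notin> C" "(v, w) \<in> E\<^sup>*" for e
        using that by (intro cut_apply) (auto simp: P_def)
      then show ?thesis unfolding H_def by (auto intro!: sum.cong)
    qed
    finally show ?thesis .
  qed
  have d_class: "d v = 1" if "v \<in> C" for v using d[of v] that by (simp add: H_def)
  have d_other: "d v = 0" if "(v, w) \<notin> E\<^sup>*" for v
    using d[of v] that by (simp add: H_def C_def)
  have "d v = (\<Sum>e\<in>out_arcs G v. d (head G e))" if v: "v \<in> verts G" "out_arcs G v \<noteq> {}" for v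
  proof -
    consider "v \<in> C" | "v \<notin> C" "(v, w) \<in> E\<^sup>*" | "(v, w) \<notin> E\<^sup>*" by blast
    then show ?thesis
    proof cases
      case 1
      then have vw: "(v, w) \<in> E\<^sup>*" and wv': "(w, v) \<in> E\<^sup>*" by (auto simp: C_def)
      have "(v, v) \<in> E\<^sup>+"
      proof (cases "v = w")
        case True
        then show ?thesis using w v by (simp add: T_def)
      next
        case False
        then have "(v, w) \<in> E\<^sup>+" using vw by (simp add: rtrancl_eq_or_trancl)
        then show ?thesis using wv' by (rule trancl_rtrancl_trancl)
      qed
      then obtain u where "(v, u) \<in> E" "(u, v) \<in> E\<^sup>*" by (auto dest: tranclD)
      then obtain e where e: "e \<in> out_arcs G v" "(head G e, v) \<in> E\<^sup>*"
        using E_tail by blast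
      \<comment> \<open>If the head of an arc other than \<open>e\<close> reached \<open>w\<close>,
        it would reach \<open>v\<close> as well, and \<open>v\<close> would have a second returning
        arc.\<close>
      have "d (head G f) = (if f = e then 1 else 0)" if f: "f \<in> out_arcs G v" for f
      proof (cases "f = e")
        case True
        have "(w, head G e) \<in> E\<^sup>*"
          using wv' E_arc[of e] e(1) by (auto intro: rtrancl_into_rtrancl)
        then have "head G e \<in> C" using e(2) vw by (auto simp: C_def)
        then show ?thesis using True d_class by simp
      next
        case False
        have "(head G f, v) \<notin> E\<^sup>*"
          using unique[of f e v] e f False by (auto simp: E_def)
        then have "(head G f, w) \<notin> E\<^sup>*" using rtrancl_trans[OF _ wv'] by blast
        then show ?thesis using False d_other by simp
      qed
      then have "(\<Sum>f\<in>out_arcs G v. d (head G f)) = (\<Sum>f\<in>out_arcs G v. if f = e then 1 else 0)"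
        by (intro sum.cong) auto
      then show ?thesis using e(1) fin_out d_class[OF 1] by simp
    next
      case 2
      then show ?thesis using d[of v] by (simp add: H_def)
    next
      case 3
      then have "(head G e, w) \<notin> E\<^sup>*" if "e \<in> out_arcs G v" for e
        using that E_arc[of e] by (auto intro: converse_rtrancl_into_rtrancl)
      then show ?thesis using 3 d_other by simp
    qed
  qed
  moreover have "w \<in> C" by (simp add: C_def)
  ultimately show ?thesis using wv d_class by (metis one_neq_zero)
qed

lemma leavitt_kappa: "leavitt_hom.\<kappa> (cls G) = (\<lambda>c :: 'k::field. cls G (ncconst c))"
  if "fin_digraph G" for G :: "('v, 'e) pre_digraph"
proof -
  interpret leavitt_hom G "leavitt_path_algebra TYPE('k) G" "cls G :: (('v, 'e) leavitt_gen, 'k) ncpoly \<Rightarrow> _"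
    by (rule leavitt_hom_cls[OF that])
  show ?thesis by (simp add: \<kappa>_def fun_eq_iff)
qed

lemma GK_dim_infinite_of_two_returns:
  fixes G :: "('v, 'e) pre_digraph"
  assumes G: "fin_digraph G" and ef: "e \<in> arcs G" "f \<in> arcs G" "e \<noteq> f" "tail G e = v" "tail G f = v"
    and ret: "(head G e, v) \<in> (arcs_ends G)\<^sup>*" "(head G f, v) \<in> (arcs_ends G)\<^sup>*"
  shows "GK_dim (leavitt_scalars TYPE('k::field) G) (leavitt_path_algebra TYPE('k) G) = \<infinity>"
proof -
  interpret leavitt_hom G "leavitt_path_algebra TYPE('k) G" "cls G :: (('v, 'e) leavitt_gen, 'k) ncpoly \<Rightarrow> _"
    by (rule leavitt_hom_cls[OF G])
  have "v \<in> verts G" using ef by auto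
  from two_returning_arcs(1)[OF ef ret leavitt_vert_nonzero[OF G this]] show ?thesis
    by (simp add: leavitt_scalars_eq leavitt_kappa[OF G])
qed

theorem fd_quotient_of_finite_GK_dim:
  assumes G: "fin_digraph (G :: ('v, 'e) pre_digraph)" "verts G \<noteq> {}"
    and GK: "GK_dim (leavitt_scalars TYPE('k::field) G) (leavitt_path_algebra TYPE('k) G) < \<infinity>"
  shows "has_nonzero_fd_quotient (leavitt_scalars TYPE('k) G) (leavitt_path_algebra TYPE('k) G)"
proof -
  have "\<exists>d :: 'v \<Rightarrow> nat. (\<exists>w \<in> verts G. d w \<noteq> 0) \<and>
    (\<forall>v \<in> verts G. out_arcs G v \<noteq> {} \<longrightarrow> d v = (\<Sum>e\<in>out_arcs G v. d (head G e)))"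
  proof (rule harmonic_exists[OF G], rule ccontr)
    fix v e f
    assume *: "e \<in> arcs G" "f \<in> arcs G" "tail G e = v" "tail G f = v"
      "(head G e, v) \<in> (arcs_ends G)\<^sup>*" "(head G f, v) \<in> (arcs_ends G)\<^sup>*" "e \<noteq> f"
    show False
      using GK unfolding GK_dim_infinite_of_two_returns[OF G(1) *(1,2,7,3-6)] by simp
  qed
  then obtain d :: "'v \<Rightarrow> nat" and w where
    "w \<in> verts G" "d w \<noteq> 0"
    "\<And>v. v \<in> verts G \<Longrightarrow> out_arcs G v \<noteq> {} \<Longrightarrow> d v = (\<Sum>e\<in>out_arcs G v. d (head G e))"
    by blast
  then show ?thesis by (intro fd_quotient_of_harmonic[OF G(1)]) auto
qed

section \<open>Two digraphs that refute the converses\<close>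

definition loops_and_point :: "(nat, nat) pre_digraph" where
  "loops_and_point = \<lparr>verts = {0, 1}, arcs = {0, 1}, tail = (\<lambda>_. 0), head = (\<lambda>_. 0)\<rparr>"

lemma fin_digraph_loops_and_point: "fin_digraph loops_and_point"
  by unfold_locales (auto simp: loops_and_point_def)

text \<open>The identity is the indicator of the isolated vertex 1: its value 0 at the vertex with
  two loops solves d(0) = d(0) + d(0).\<close>

lemma loops_and_point_fd:
  "has_nonzero_fd_quotient (leavitt_scalars TYPE('k::field) loops_and_point)
     (leavitt_path_algebra TYPE('k) loops_and_point)"
  by (rule fd_quotient_of_harmonic[OF fin_digraph_loops_and_point, where d = id and w = 1])
    (auto simp: loops_and_point_def out_arcs_def)

lemma loops_and_point_GK:
  "GK_dim (leavitt_scalars TYPE('k::field) loops_and_point)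
     (leavitt_path_algebra TYPE('k) loops_and_point) = \<infinity>"
  by (rule GK_dim_infinite_of_two_returns[OF fin_digraph_loops_and_point, where e = 0 and f = 1 and v = 0])
    (auto simp: loops_and_point_def)

text \<open>Arcs 0 and 1 are the loops at 0, and arcs 2 and 3 lead to the sink 1. Two of the latter
  are needed: with a single one the solution would be (-1, 1) with sum 0, and the regular module
  would be isomorphic to its own square.\<close>

definition loops_to_sink :: "(nat, nat) pre_digraph" where
  "loops_to_sink = \<lparr>verts = {0, 1}, arcs = {0, 1, 2, 3}, tail = (\<lambda>_. 0), head = (\<lambda>e. if e < 2 then 0 else 1)\<rparr>"

lemma fin_digraph_loops_to_sink: "fin_digraph loops_to_sink"
  by unfold_locales (auto simp: loops_to_sink_def)

text \<open>The two loops force vertex 0 to vanish in a finite-dimensional quotient. Then arc 2,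
  which starts there, vanishes, and by (CK1) so does the sink; no vertex is left to make up the
  unit.\<close>

lemma loops_to_sink_no_fd:
  "\<not> has_nonzero_fd_quotient (leavitt_scalars TYPE('k::field) loops_to_sink)
     (leavitt_path_algebra TYPE('k) loops_to_sink)"
proof
  let ?G = loops_to_sink
  let ?A = "leavitt_path_algebra TYPE('k) ?G"
  note G = fin_digraph_loops_to_sink
  assume "has_nonzero_fd_quotient (leavitt_scalars TYPE('k) ?G) ?A"
  then obtain I where I: "ideal I ?A" and nz: "carrier (?A Quot I) \<noteq> {\<zero>\<^bsub>?A Quot I\<^esub>}"
    and fin: "ring.finite_dimension (?A Quot I) ((\<lambda>c. I +>\<^bsub>?A\<^esub> c) ` leavitt_scalars TYPE('k) ?G) (carrier (?A Quot I))"
    unfolding has_nonzero_fd_quotient_def by blast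
  interpret Q: leavitt_hom ?G "?A Quot I" "\<lambda>p :: ((nat, nat) leavitt_gen, 'k) ncpoly. I +>\<^bsub>?A\<^esub> cls ?G p"
    by (rule leavitt_hom_quotient[OF G I])
  have scalars: "(\<lambda>c. I +>\<^bsub>?A\<^esub> c) ` leavitt_scalars TYPE('k) ?G = range Q.\<kappa>"
    by (auto simp: leavitt_scalars_eq Q.\<kappa>_def)
  have zero: "Q.\<nu> 0 = \<zero>\<^bsub>?A Quot I\<^esub>"
  proof (rule ccontr)
    assume "Q.\<nu> 0 \<noteq> \<zero>\<^bsub>?A Quot I\<^esub>"
    then have "\<not> Q.B.finite_dimension (range Q.\<kappa>) (carrier (?A Quot I))"
      by (intro Q.two_returning_arcs(2)[where e = 0 and f = 1 and v = 0]) (auto simp: loops_to_sink_def)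
    then show False using fin unfolding scalars by (rule notE)
  qed
  have arc: "2 \<in> arcs ?G" "head ?G 2 = 1" "tail ?G 2 = 0" "1 \<in> verts ?G"
    by (auto simp: loops_to_sink_def)
  have "Q.\<alpha> 2 = \<zero>\<^bsub>?A Quot I\<^esub>"
    using Q.arc_simps(1)[OF arc(1)] Q.gen_closed(2)[OF arc(1)] unfolding arc zero by simp
  then have one: "Q.\<nu> 1 = \<zero>\<^bsub>?A Quot I\<^esub>"
    using Q.ghost_arc[OF arc(1) arc(1)] Q.gen_closed(3)[OF arc(1)] unfolding arc by simp
  have verts: "verts ?G = {0, 1}"
    by (simp add: loops_to_sink_def)
  have "Q.\<nu> v = \<zero>\<^bsub>?A Quot I\<^esub>" if "v \<in> verts ?G" for v
  proof -
    from that verts consider "v = 0" | "v = 1" by auto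
    then show ?thesis by cases (simp_all only: zero one)
  qed
  then have "(\<Oplus>\<^bsub>?A Quot I\<^esub>v\<in>verts ?G. Q.\<nu> v) = (\<Oplus>\<^bsub>?A Quot I\<^esub>v\<in>verts ?G. \<zero>\<^bsub>?A Quot I\<^esub>)"
    by (intro Q.B.finsum_cong' refl) simp_all
  then have "\<one>\<^bsub>?A Quot I\<^esub> = \<zero>\<^bsub>?A Quot I\<^esub>"
    using Q.one_eq_sum_verts by (simp only: Q.B.finsum_zero)
  from Q.B.one_zeroD[OF this] show False
    by (rule notE[OF nz])
qed

text \<open>Compared with \<open>X'\<close>, the system \<open>X\<close> has one more point at the sink and two fewer at the
  vertex \<open>0\<close>.\<close>

lemma loops_to_sink_IBN: "IBN (leavitt_path_algebra TYPE('k::field) loops_to_sink)"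
proof -
  \<comment> \<open>The loops are n \<mapsto> 2n and n \<mapsto> 2n + 1; arcs 2 and 3 send the only
    possible sink point to their own number.\<close>
  define \<phi> :: "nat \<Rightarrow> nat \<Rightarrow> nat" where
    "\<phi> e n = (if e = 0 then 2 * n else if e = 1 then 2 * n + 1 else e)" for e n
  \<comment> \<open>The loops map {2, 3, ...} onto {4, 5, ...}, and the missing points 2 and 3 are
    the values of the arcs 2 and 3 at the sink point 0.\<close>
  define X where "X v = (if v = (0 :: nat) then {2 :: nat..} else {0})" for v
  \<comment> \<open>With no point at the sink the loops alone split all natural numbers by parity.
    Labelling the sink point of \<open>X\<close> by 0 keeps the unions nested, with 1 as the only
    extra point here.\<close>
  define X' where "X' v = (if v = (0 :: nat) then (UNIV :: nat set) else {})" for v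
  have out: "out_arcs loops_to_sink 0 = {0, 1, 2, 3}" "out_arcs loops_to_sink 1 = {}"
    by (auto simp: loops_to_sink_def out_arcs_def)
  have X: "branching loops_to_sink X \<phi>"
  proof (rule branching.intro[OF fin_digraph_loops_to_sink], rule branching_axioms.intro)
    fix v assume v: "v \<in> verts loops_to_sink" "out_arcs loops_to_sink v \<noteq> {}"
    then have "v = 0" using out(2) by (auto simp: loops_to_sink_def)
    have "bij_betw (\<lambda>(e, x). \<phi> e x) (SIGMA e:{0, 1, 2, 3}. X (head loops_to_sink e)) (X 0)"
    proof (rule bij_betw_imageI)
      show "inj_on (\<lambda>(e, x). \<phi> e x) (SIGMA e:{0, 1, 2, 3}. X (head loops_to_sink e))"
        by (rule inj_onI) (auto simp: \<phi>_def X_def loops_to_sink_def; presburger)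
      have "n \<in> (\<lambda>(e, x). \<phi> e x) ` (SIGMA e:{0, 1, 2, 3}. X (head loops_to_sink e))" if n: "2 \<le> n" for n
      proof -
        have "n = 2 \<or> n = 3 \<or> 4 \<le> n" using n by linarith
        then consider "n = 2" | "n = 3" | "4 \<le> n" "even n" | "4 \<le> n" "odd n" by blast
        then show ?thesis
        proof cases
          case 1
          then show ?thesis by (intro image_eqI[of _ _ "(2, 0)"]) (auto simp: \<phi>_def X_def loops_to_sink_def)
        next
          case 2
          then show ?thesis by (intro image_eqI[of _ _ "(3, 0)"]) (auto simp: \<phi>_def X_def loops_to_sink_def)
        next
          case 3
          then show ?thesis
            by (intro image_eqI[of _ _ "(0, n div 2)"]) (auto simp: \<phi>_def X_def loops_to_sink_def)
        next
          case 4
          then show ?thesis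
            by (intro image_eqI[of _ _ "(1, n div 2)"]) (auto simp: \<phi>_def X_def loops_to_sink_def)
        qed
      qed
      then show "(\<lambda>(e, x). \<phi> e x) ` (SIGMA e:{0, 1, 2, 3}. X (head loops_to_sink e)) = X 0"
        by (auto simp: \<phi>_def X_def loops_to_sink_def split: if_splits)
    qed
    then show "bij_betw (\<lambda>(e, x). \<phi> e x) (SIGMA e:out_arcs loops_to_sink v. X (head loops_to_sink e)) (X v)"
      unfolding \<open>v = 0\<close> out .
  qed (auto simp: loops_to_sink_def X_def split: if_splits)
  have X': "branching loops_to_sink X' \<phi>"
  proof (rule branching.intro[OF fin_digraph_loops_to_sink], rule branching_axioms.intro)
    fix v assume v: "v \<in> verts loops_to_sink" "out_arcs loops_to_sink v \<noteq> {}"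
    then have "v = 0" using out(2) by (auto simp: loops_to_sink_def)
    have "bij_betw (\<lambda>(e, x). \<phi> e x) (SIGMA e:{0, 1, 2, 3}. X' (head loops_to_sink e)) (X' 0)"
    proof (rule bij_betw_imageI)
      show "inj_on (\<lambda>(e, x). \<phi> e x) (SIGMA e:{0, 1, 2, 3}. X' (head loops_to_sink e))"
        by (rule inj_onI) (auto simp: \<phi>_def X'_def loops_to_sink_def; presburger)
      have "n \<in> (\<lambda>(e, x). \<phi> e x) ` (SIGMA e:{0, 1, 2, 3}. X' (head loops_to_sink e))" for n
        by (cases "even n"; intro image_eqI[of _ _ "(n mod 2, n div 2)"])
          (auto simp: \<phi>_def X'_def loops_to_sink_def odd_iff_mod_2_eq_one)
      then show "(\<lambda>(e, x). \<phi> e x) ` (SIGMA e:{0, 1, 2, 3}. X' (head loops_to_sink e)) = X' 0"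
        by (auto simp: X'_def)
    qed
    then show "bij_betw (\<lambda>(e, x). \<phi> e x) (SIGMA e:out_arcs loops_to_sink v. X' (head loops_to_sink e)) (X' v)"
      unfolding \<open>v = 0\<close> out .
  qed (auto simp: loops_to_sink_def X'_def split: if_splits)
  show ?thesis
  proof (rule IBN_of_almost_equal_branchings[OF X X'])
    show "finite (X v - X' v)" "finite (X' v - X v)" for v
    proof -
      have "X v - X' v \<subseteq> {0}" "X' v - X v \<subseteq> {0, 1}" by (auto simp: X_def X'_def)
      then show "finite (X v - X' v)" "finite (X' v - X v)" by (auto intro: finite_subset)
    qed
    have "1 \<notin> (\<Union>v\<in>verts loops_to_sink. X v)" by (auto simp: X_def)
    moreover have "(\<Union>v\<in>verts loops_to_sink. X' v) = UNIV"
      by (auto simp: X'_def loops_to_sink_def)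
    ultimately show "(\<Union>v\<in>verts loops_to_sink. X v) \<subset> (\<Union>v\<in>verts loops_to_sink. X' v)"
      by auto
  qed
qed

theorem corollary6p9:
  shows "(\<forall>G :: ('v, 'e) pre_digraph. fin_digraph G \<and> verts G \<noteq> {} \<longrightarrow>
            (GK_dim (leavitt_scalars TYPE('k::field) G) (leavitt_path_algebra TYPE('k) G) < \<infinity> \<longrightarrow>
               has_nonzero_fd_quotient (leavitt_scalars TYPE('k) G) (leavitt_path_algebra TYPE('k) G)) \<and>
            (has_nonzero_fd_quotient (leavitt_scalars TYPE('k) G) (leavitt_path_algebra TYPE('k) G) \<longrightarrow>
               IBN (leavitt_path_algebra TYPE('k) G))) \<and>
         (\<exists>G1 :: (nat, nat) pre_digraph. fin_digraph G1 \<and> verts G1 \<noteq> {} \<and>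
            has_nonzero_fd_quotient (leavitt_scalars TYPE('k) G1) (leavitt_path_algebra TYPE('k) G1) \<and>
            GK_dim (leavitt_scalars TYPE('k) G1) (leavitt_path_algebra TYPE('k) G1) = \<infinity>) \<and>
         (\<exists>G2 :: (nat, nat) pre_digraph. fin_digraph G2 \<and> verts G2 \<noteq> {} \<and>
            IBN (leavitt_path_algebra TYPE('k) G2) \<and>
            \<not> has_nonzero_fd_quotient (leavitt_scalars TYPE('k) G2) (leavitt_path_algebra TYPE('k) G2))"
proof (intro conjI allI impI)
  fix G :: "('v, 'e) pre_digraph"
  assume G: "fin_digraph G \<and> verts G \<noteq> {}"
  show "has_nonzero_fd_quotient (leavitt_scalars TYPE('k) G) (leavitt_path_algebra TYPE('k) G)"
    if "GK_dim (leavitt_scalars TYPE('k) G) (leavitt_path_algebra TYPE('k) G) < \<infinity>"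
    using G that by (intro fd_quotient_of_finite_GK_dim) simp_all
  show "IBN (leavitt_path_algebra TYPE('k) G)"
    if "has_nonzero_fd_quotient (leavitt_scalars TYPE('k) G) (leavitt_path_algebra TYPE('k) G)"
    using G that by (intro IBN_of_fd_quotient) simp_all
next
  show "\<exists>G1 :: (nat, nat) pre_digraph. fin_digraph G1 \<and> verts G1 \<noteq> {} \<and>
      has_nonzero_fd_quotient (leavitt_scalars TYPE('k) G1) (leavitt_path_algebra TYPE('k) G1) \<and>
      GK_dim (leavitt_scalars TYPE('k) G1) (leavitt_path_algebra TYPE('k) G1) = \<infinity>"
    by (intro exI[of _ loops_and_point] conjI fin_digraph_loops_and_point loops_and_point_fd loops_and_point_GK)
      (simp add: loops_and_point_def)
  show "\<exists>G2 :: (nat, nat) pre_digraph. fin_digraph G2 \<and> verts G2 \<noteq> {} \<and>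
      IBN (leavitt_path_algebra TYPE('k) G2) \<and>
      \<not> has_nonzero_fd_quotient (leavitt_scalars TYPE('k) G2) (leavitt_path_algebra TYPE('k) G2)"
    by (intro exI[of _ loops_to_sink] conjI fin_digraph_loops_to_sink loops_to_sink_IBN loops_to_sink_no_fd)
      (simp add: loops_to_sink_def)
qed

end
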